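(* Let $(X,\mathcal{U})$ be a uniform space and let $f\colon X\to X$ be a continuous function (with respect to the topology $\tau(\mathcal{U})$). Then the following conditions are equivalent: (i) $f\colon (X,\mathcal{U})\to (X,\mathcal{U})$ is weakly mixing; (ii) $\overline{f}\colon (\mathcal{K}(X),\mathcal{K}(\mathcal{U}))\to(\mathcal{K}(X),\mathcal{K}(\mathcal{U}))$ is transitive; (iii) $\widehat{f}\colon (\mathcal{F}(X),\mathcal{U}_\infty)\to(\mathcal{F}(X),\mathcal{U}_\infty)$ is transitive; (iv) $\widehat{f}\colon (\mathcal{F}(X),\mathcal{U}_0)\to(\mathcal{F}(X),\mathcal{U}_0)$ is transitive; (v) $\widehat{f}\colon (\mathcal{F}(X),\mathcal{U}_S)\to(\mathcal{F}(X),\mathcal{U}_S)$ is transitive.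
   Context: Uniform spaces. A uniform space $(X,\mathcal{U})$ is a non-empty set $X$ with a uniformity $\mathcal{U}$ given by entourages of the diagonal, assumed separated: $\bigcap_{U\in\mathcal{U}}U=\Delta_X$. For $U\in\mathcal{U}$, $x\in X$, $A\subseteq X$, put $U(x)=\{y\in X:(x,y)\in U\}$ and $U(A)=\bigcup_{x\in A}U(x)$. The induced topology is $\tau(\mathcal{U})=\{V\subseteq X: \text{for every }x\in V\text{ there is }U\in\mathcal{U}\text{ with }U(x)\subseteq V\}$. All topological notions on a uniform space (continuity, compactness, transitivity, etc.) refer to the induced topology. Hyperspace. $\mathcal{K}(X)$ is the set of non-empty compact subsets of $(X,\tau(\mathcal{U}))$. For $U\in\mathcal{U}$, $\mathcal{K}[U]=\{(A,B)\in\mathcal{K}(X)\times\mathcal{K}(X): A\subseteq U(B),\ B\subseteq U(A)\}$; the sets $\mathcal{K}[U]$, $U\in\mathcal{U}$, form a base of a uniformity $\mathcal{K}(\mathcal{U})$ on $\mathcal{K}(X)$ (whose topology is the Vietoris topology). For continuous $f\colon X\to X$, $\overline{f}\colon\mathcal{K}(X)\to\mathcal{K}(X)$ is $\overline{f}(A)=f(A)$. Fuzzy sets. Let $\mathbb{I}=[0,1]$. A fuzzy set on $X$ is a function $u\colon X\to\mathbb{I}$; its $\alpha$-cut is $u_\alpha=\{x\in X:u(x)\ge\alpha\}$ for $\alpha\in(0,1]$, and its support is $u_0=\overline{\{x\in X:u(x)>0\}}$. $u$ is normal if $u(x)=1$ for some $x$. $\mathcal{F}(X)$ is the set of all normal upper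 semicontinuous fuzzy sets on $X$ with compact support (so $u_\alpha\in\mathcal{K}(X)$ for all $\alpha\in\mathbb{I}$). Zadeh's extension $\widehat{f}\colon\mathcal{F}(X)\to\mathcal{F}(X)$ of a continuous $f\colon X\to X$ is $\widehat{f}(u)(x)=\sup\{u(z):z\in f^{-1}(x)\}$ if $f^{-1}(x)\ne\emptyset$, and $\widehat{f}(u)(x)=0$ otherwise. Uniformities on $\mathcal{F}(X)$. - Level-wise uniformity $\mathcal{U}_\infty$: base $\{\mathcal{F}[U]:U\in\mathcal{U}\}$, where $\mathcal{F}[U]=\{(u,v)\in\mathcal{F}(X)^2:(u_\alpha,v_\alpha)\in\mathcal{K}[U]\text{ for all }\alpha\in\mathbb{I}\}$. - Skorokhod uniformity $\mathcal{U}_0$: let $\mathbb{T}$ be the set of increasing homeomorphisms of $[0,1]$ onto itself and $\|t\|=\sup\{|t(\alpha)-\alpha|:\alpha\in\mathbb{I}\}$. Base $\{G[U,\epsilon]:U\in\mathcal{U},\epsilon>0\}$, where $G[U,\epsilon]$ is the set of $(u,v)\in\mathcal{F}(X)^2$ for which there is $t\in\mathbb{T}$ with $\|t\|<\epsilon$ and $(u_\alpha,v_{t(\alpha)})\in\mathcal{K}[U]$ for all $\alpha\in\mathbb{I}$. - Sendograph uniformity $\mathcal{U}_S$: the sendograph of $u$ is $\mathrm{send}(u)=\{(x,\alpha)\in X\times\mathbb{I}:u(x)\ge\alpha\}\cap(u_0\times\mathbb{I})$, an element of $\mathcal{K}(X\times\mathbb{I})$. With $V_\epsilon=\{(\alpha,\beta)\in\mathbb{I}^2:|\alpha-\beta|<\epsilon\}$,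 and $U\times V_\epsilon$ regarded as the entourage $\{((x,\alpha),(y,\beta)):(x,y)\in U,(\alpha,\beta)\in V_\epsilon\}$ of $X\times\mathbb{I}$, a base is $\{S[U,\epsilon]:U\in\mathcal{U},\epsilon>0\}$, where $S[U,\epsilon]=\{(u,v)\in\mathcal{F}(X)^2:(\mathrm{send}(u),\mathrm{send}(v))\in\mathcal{K}[U\times V_\epsilon]\}$. (It is known that these families are bases of uniformities and that $\overline f$ and $\widehat{f}$ are continuous for the respective topologies.) Dynamics. For a topological space $Y$ and a continuous $g\colon Y\to Y$, $g$ is transitive if for all non-empty open $P,Q\subseteq Y$ there is $n\in\mathbb{N}=\{1,2,\dots\}$ with $g^n(P)\cap Q\neq\emptyset$; $g$ is weakly mixing if $g\times g\colon Y\times Y\to Y\times Y$ is transitive. *)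

theory Defs
  imports "HOL-Analysis.Analysis"
begin

section \<open>Uniformities with an explicit carrier\<close>

text \<open>The library presents a uniformity (class \<^class>\<open>uniform_space\<close>) as a filter on pairs;
  its members are the entourages. The class axiom \<open>open_uniformity\<close> says that \<^const>\<open>open\<close> is the
  topology induced by these entourages.\<close>

definition entourages :: "('a::uniform_space \<times> 'a) set set" where
  "entourages = {U. eventually (\<lambda>p. p \<in> U) uniformity}"

definition separated_uniformity :: "'a::uniform_space itself \<Rightarrow> bool" where
  "separated_uniformity _ \<longleftrightarrow> \<Inter>(entourages :: ('a \<times> 'a) set set) = Id"

text \<open>The hyperspace and the space of fuzzy sets are not whole types, and the latter carries three
  uniformities, so these uniformities are sets of relations on an explicit carrier \<open>Y\<close>.\<close>

definition uniformity_of_base :: "'b set \<Rightarrow> ('b \<times> 'b) set set \<Rightarrow> ('b \<times> 'b) set set" where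
  "uniformity_of_base Y \<B> = {W. W \<subseteq> Y \<times> Y \<and> (\<exists>E\<in>\<B>. E \<subseteq> W)}"

definition uniform_topology :: "'b set \<Rightarrow> ('b \<times> 'b) set set \<Rightarrow> 'b topology" where
  "uniform_topology Y \<W> = topology (\<lambda>V. V \<subseteq> Y \<and> (\<forall>x\<in>V. \<exists>W\<in>\<W>. W `` {x} \<subseteq> V))"


section \<open>Hyperspace\<close>

definition hyperspace :: "'b::topological_space set \<Rightarrow> 'b set set" where
  "hyperspace S = {A. A \<subseteq> S \<and> A \<noteq> {} \<and> compact A}"

text \<open>For an entourage \<open>U\<close> the set \<open>U(A)\<close> is the relational image \<open>U `` A\<close>.\<close>

definition hyper_ent :: "'b::topological_space set \<Rightarrow> ('b \<times> 'b) set \<Rightarrow> ('b set \<times> 'b set) set" where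
  "hyper_ent S U = {(A, B) \<in> hyperspace S \<times> hyperspace S. A \<subseteq> U `` B \<and> B \<subseteq> U `` A}"

definition hyper_uniformity :: "('a::uniform_space set \<times> 'a set) set set" where
  "hyper_uniformity = uniformity_of_base (hyperspace UNIV) (hyper_ent UNIV ` entourages)"


section \<open>Fuzzy sets\<close>

definition fuzzy_supp :: "('a::topological_space \<Rightarrow> real) \<Rightarrow> 'a set" where
  "fuzzy_supp u = closure {x. u x > 0}"

definition cut :: "('a::topological_space \<Rightarrow> real) \<Rightarrow> real \<Rightarrow> 'a set" where
  "cut u \<alpha> = (if \<alpha> = 0 then fuzzy_supp u else {x. u x \<ge> \<alpha>})"

definition upper_semicont :: "('a::topological_space \<Rightarrow> real) \<Rightarrow> bool" where
  "upper_semicont u \<longleftrightarrow> (\<forall>c. open {x. u x < c})"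

definition fuzzy_space :: "('a::topological_space \<Rightarrow> real) set" where
  "fuzzy_space = {u. (\<forall>x. u x \<in> {0..1}) \<and> (\<exists>x. u x = 1) \<and> upper_semicont u \<and> compact (fuzzy_supp u)}"

definition zadeh :: "('a \<Rightarrow> 'a) \<Rightarrow> ('a \<Rightarrow> real) \<Rightarrow> 'a \<Rightarrow> real" where
  "zadeh f u x = (if f -` {x} \<noteq> {} then (SUP z\<in>f -` {x}. u z) else 0)"


subsection \<open>Level-wise uniformity\<close>

definition level_ent ::
    "('a::uniform_space \<times> 'a) set \<Rightarrow> (('a \<Rightarrow> real) \<times> ('a \<Rightarrow> real)) set" where
  "level_ent U = {(u, v) \<in> fuzzy_space \<times> fuzzy_space.
     \<forall>\<alpha>\<in>{0..1}. (cut u \<alpha>, cut v \<alpha>) \<in> hyper_ent UNIV U}"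

definition level_uniformity :: "(('a::uniform_space \<Rightarrow> real) \<times> ('a \<Rightarrow> real)) set set" where
  "level_uniformity = uniformity_of_base fuzzy_space (level_ent ` entourages)"


subsection \<open>Skorokhod uniformity\<close>

text \<open>Only the values of a time change on the unit interval matter.\<close>

definition time_changes :: "(real \<Rightarrow> real) set" where
  "time_changes = {t. (\<exists>s. homeomorphism {0..1} {0..1} t s) \<and> strict_mono_on {0..1} t}"

definition time_norm :: "(real \<Rightarrow> real) \<Rightarrow> real" where
  "time_norm t = (SUP \<alpha>\<in>{0..1}. \<bar>t \<alpha> - \<alpha>\<bar>)"

definition skorokhod_ent ::
    "('a::uniform_space \<times> 'a) set \<Rightarrow> real \<Rightarrow> (('a \<Rightarrow> real) \<times> ('a \<Rightarrow> real)) set" where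
  "skorokhod_ent U \<epsilon> = {(u, v) \<in> fuzzy_space \<times> fuzzy_space.
     \<exists>t\<in>time_changes. time_norm t < \<epsilon> \<and>
       (\<forall>\<alpha>\<in>{0..1}. (cut u \<alpha>, cut v (t \<alpha>)) \<in> hyper_ent UNIV U)}"

definition skorokhod_uniformity :: "(('a::uniform_space \<Rightarrow> real) \<times> ('a \<Rightarrow> real)) set set" where
  "skorokhod_uniformity =
     uniformity_of_base fuzzy_space {skorokhod_ent U \<epsilon> |U \<epsilon>. U \<in> entourages \<and> \<epsilon> > 0}"


subsection \<open>Sendograph uniformity\<close>

definition sendograph :: "('a::topological_space \<Rightarrow> real) \<Rightarrow> ('a \<times> real) set" where
  "sendograph u = {(x, \<alpha>). \<alpha> \<in> {0..1} \<and> u x \<ge> \<alpha>} \<inter> (fuzzy_supp u \<times> {0..1})"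

definition unit_ent :: "real \<Rightarrow> (real \<times> real) set" where
  "unit_ent \<epsilon> = {(\<alpha>, \<beta>) \<in> {0..1} \<times> {0..1}. \<bar>\<alpha> - \<beta>\<bar> < \<epsilon>}"

definition prod_ent :: "('a \<times> 'a) set \<Rightarrow> ('b \<times> 'b) set \<Rightarrow> (('a \<times> 'b) \<times> ('a \<times> 'b)) set" where
  "prod_ent U V = {((x, \<alpha>), (y, \<beta>)). (x, y) \<in> U \<and> (\<alpha>, \<beta>) \<in> V}"

definition sendograph_ent ::
    "('a::uniform_space \<times> 'a) set \<Rightarrow> real \<Rightarrow> (('a \<Rightarrow> real) \<times> ('a \<Rightarrow> real)) set" where
  "sendograph_ent U \<epsilon> = {(u, v) \<in> fuzzy_space \<times> fuzzy_space.
     (sendograph u, sendograph v) \<in> hyper_ent (UNIV \<times> {0..1}) (prod_ent U (unit_ent \<epsilon>))}"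

definition sendograph_uniformity :: "(('a::uniform_space \<Rightarrow> real) \<times> ('a \<Rightarrow> real)) set set" where
  "sendograph_uniformity =
     uniformity_of_base fuzzy_space {sendograph_ent U \<epsilon> |U \<epsilon>. U \<in> entourages \<and> \<epsilon> > 0}"


section \<open>Dynamics\<close>

definition transitive_map :: "'b topology \<Rightarrow> ('b \<Rightarrow> 'b) \<Rightarrow> bool" where
  "transitive_map T g \<longleftrightarrow>
     (\<forall>P Q. openin T P \<and> P \<noteq> {} \<and> openin T Q \<and> Q \<noteq> {} \<longrightarrow> (\<exists>n\<ge>1. (g ^^ n) ` P \<inter> Q \<noteq> {}))"

definition weakly_mixing_map :: "'b topology \<Rightarrow> ('b \<Rightarrow> 'b) \<Rightarrow> bool" where
  "weakly_mixing_map T g \<longleftrightarrow> transitive_map (prod_topology T T) (map_prod g g)"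


section \<open>The induced topologies are as intended\<close>

text \<open>The constant \<^const>\<open>topology\<close> is meaningful only for predicates satisfying \<^const>\<open>istopology\<close>.
  The following facts establish this for the four uniformities above.\<close>

lemma openin_uniform_topology_base:
  assumes "\<And>E F. E \<in> \<B> \<Longrightarrow> F \<in> \<B> \<Longrightarrow> \<exists>G\<in>\<B>. G \<subseteq> E \<inter> F"
    and sub: "\<And>E. E \<in> \<B> \<Longrightarrow> E \<subseteq> Y \<times> Y"
  shows "openin (uniform_topology Y (uniformity_of_base Y \<B>)) V \<longleftrightarrow>
    V \<subseteq> Y \<and> (\<forall>x\<in>V. \<exists>E\<in>\<B>. E `` {x} \<subseteq> V)"
proof -
  have eq: "(\<lambda>V. V \<subseteq> Y \<and> (\<forall>x\<in>V. \<exists>W\<in>uniformity_of_base Y \<B>. W `` {x} \<subseteq> V))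
      = (\<lambda>V. V \<subseteq> Y \<and> (\<forall>x\<in>V. \<exists>E\<in>\<B>. E `` {x} \<subseteq> V))"
  proof -
    have "(\<exists>W\<in>uniformity_of_base Y \<B>. W `` {x} \<subseteq> V) \<longleftrightarrow> (\<exists>E\<in>\<B>. E `` {x} \<subseteq> V)" for x V
      unfolding uniformity_of_base_def using sub by blast
    then show ?thesis by simp
  qed
  have "istopology (\<lambda>V. V \<subseteq> Y \<and> (\<forall>x\<in>V. \<exists>E\<in>\<B>. E `` {x} \<subseteq> V))"
    unfolding istopology_def
  proof (intro conjI allI impI)
    fix S T assume S: "S \<subseteq> Y \<and> (\<forall>x\<in>S. \<exists>E\<in>\<B>. E `` {x} \<subseteq> S)"
      and T: "T \<subseteq> Y \<and> (\<forall>x\<in>T. \<exists>E\<in>\<B>. E `` {x} \<subseteq> T)"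
    show "S \<inter> T \<subseteq> Y" using S by blast
    show "\<forall>x\<in>S \<inter> T. \<exists>E\<in>\<B>. E `` {x} \<subseteq> S \<inter> T"
    proof
      fix x assume "x \<in> S \<inter> T"
      then obtain E F where "E \<in> \<B>" "F \<in> \<B>" and *: "E `` {x} \<subseteq> S" "F `` {x} \<subseteq> T"
        using S T by blast
      obtain G where G: "G \<in> \<B>" "G \<subseteq> E \<inter> F" using assms(1)[OF \<open>E \<in> \<B>\<close> \<open>F \<in> \<B>\<close>] by (elim bexE)
      then have "G `` {x} \<subseteq> E `` {x} \<inter> F `` {x}" by blast
      with * have "G `` {x} \<subseteq> S \<inter> T" by (meson Int_mono subset_trans)
      with G(1) show "\<exists>E\<in>\<B>. E `` {x} \<subseteq> S \<inter> T" by (rule bexI[rotated])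
    qed
  next
    fix \<K> assume K: "\<forall>K\<in>\<K>. K \<subseteq> Y \<and> (\<forall>x\<in>K. \<exists>E\<in>\<B>. E `` {x} \<subseteq> K)"
    show "\<Union>\<K> \<subseteq> Y" by (rule Union_least) (use K in simp)
    show "\<forall>x\<in>\<Union>\<K>. \<exists>E\<in>\<B>. E `` {x} \<subseteq> \<Union>\<K>"
    proof
      fix x assume "x \<in> \<Union>\<K>"
      then obtain K where "K \<in> \<K>" "x \<in> K" by (rule UnionE)
      then obtain E where "E \<in> \<B>" "E `` {x} \<subseteq> K" using K by metis
      then show "\<exists>E\<in>\<B>. E `` {x} \<subseteq> \<Union>\<K>" using \<open>K \<in> \<K>\<close> by (meson Union_upper subset_trans)
    qed
  qed
  then show ?thesis
    unfolding uniform_topology_def eq by (simp add: topology_inverse')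
qed

lemma open_iff_entourages: "open V \<longleftrightarrow> (\<forall>x\<in>V. \<exists>U\<in>entourages. U `` {x} \<subseteq> V)"
proof -
  have "eventually (\<lambda>(x', y). x' = x \<longrightarrow> y \<in> V) uniformity \<longleftrightarrow> (\<exists>U\<in>entourages. U `` {x} \<subseteq> V)" for x
  proof
    assume "eventually (\<lambda>(x', y). x' = x \<longrightarrow> y \<in> V) uniformity"
    then have "{(x', y). x' = x \<longrightarrow> y \<in> V} \<in> entourages"
      by (simp add: entourages_def case_prod_unfold)
    moreover have "{(x', y). x' = x \<longrightarrow> y \<in> V} `` {x} \<subseteq> V" by auto
    ultimately show "\<exists>U\<in>entourages. U `` {x} \<subseteq> V" by blast
  next
    assume "\<exists>U\<in>entourages. U `` {x} \<subseteq> V"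
    then obtain U where "eventually (\<lambda>p. p \<in> U) uniformity" "U `` {x} \<subseteq> V"
      by (auto simp: entourages_def)
    then show "eventually (\<lambda>(x', y). x' = x \<longrightarrow> y \<in> V) uniformity"
      by (auto elim!: eventually_mono)
  qed
  then show ?thesis by (simp add: open_uniformity)
qed

lemma UNIV_entourages: "UNIV \<in> entourages"
  by (simp add: entourages_def)

lemma Int_entourages: "U \<in> entourages \<Longrightarrow> V \<in> entourages \<Longrightarrow> U \<inter> V \<in> entourages"
  by (simp add: entourages_def eventually_conj)

lemma hyper_ent_mono: "U \<subseteq> V \<Longrightarrow> hyper_ent S U \<subseteq> hyper_ent S V"
  unfolding hyper_ent_def by blast

lemma level_ent_mono: "U \<subseteq> V \<Longrightarrow> level_ent U \<subseteq> level_ent V"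
  unfolding level_ent_def using hyper_ent_mono[of U V UNIV] by blast

lemma skorokhod_ent_mono: "U \<subseteq> V \<Longrightarrow> \<delta> \<le> \<epsilon> \<Longrightarrow> skorokhod_ent U \<delta> \<subseteq> skorokhod_ent V \<epsilon>"
  unfolding skorokhod_ent_def using hyper_ent_mono[of U V UNIV] less_le_trans[of _ \<delta> \<epsilon>] by blast

lemma sendograph_ent_mono: "U \<subseteq> V \<Longrightarrow> \<delta> \<le> \<epsilon> \<Longrightarrow> sendograph_ent U \<delta> \<subseteq> sendograph_ent V \<epsilon>"
proof -
  assume "U \<subseteq> V" "\<delta> \<le> \<epsilon>"
  then have "prod_ent U (unit_ent \<delta>) \<subseteq> prod_ent V (unit_ent \<epsilon>)"
    unfolding prod_ent_def unit_ent_def by auto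
  then show ?thesis unfolding sendograph_ent_def using hyper_ent_mono by blast
qed

lemma directed_image_entourages:
  assumes "\<And>U V. U \<subseteq> V \<Longrightarrow> h U \<subseteq> h V" "E \<in> h ` entourages" "F \<in> h ` entourages"
  shows "\<exists>G\<in>h ` entourages. G \<subseteq> E \<inter> F"
proof -
  obtain U V where UV: "U \<in> entourages" "V \<in> entourages" "E = h U" "F = h V"
    using assms(2,3) by blast
  then have "h (U \<inter> V) \<subseteq> E \<inter> F" using assms(1)[of "U \<inter> V"] by simp
  then show ?thesis using UV Int_entourages by blast
qed

lemma directed_image2_entourages:
  assumes "\<And>U V \<delta> \<epsilon>. U \<subseteq> V \<Longrightarrow> (\<delta>::real) \<le> \<epsilon> \<Longrightarrow> h U \<delta> \<subseteq> h V \<epsilon>"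
    "E \<in> {h U \<epsilon> |U \<epsilon>. U \<in> entourages \<and> \<epsilon> > 0}" "F \<in> {h U \<epsilon> |U \<epsilon>. U \<in> entourages \<and> \<epsilon> > 0}"
  shows "\<exists>G\<in>{h U \<epsilon> |U \<epsilon>. U \<in> entourages \<and> \<epsilon> > 0}. G \<subseteq> E \<inter> F"
proof -
  obtain U V \<delta> \<epsilon> where UV: "U \<in> entourages" "V \<in> entourages" "0 < \<delta>" "0 < \<epsilon>" "E = h U \<delta>" "F = h V \<epsilon>"
    using assms(2,3) by blast
  then have "h (U \<inter> V) (min \<delta> \<epsilon>) \<subseteq> E \<inter> F" using assms(1)[of "U \<inter> V" _ "min \<delta> \<epsilon>"] by simp
  moreover have "U \<inter> V \<in> entourages" "min \<delta> \<epsilon> > 0" using UV Int_entourages by auto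
  ultimately show ?thesis by blast
qed

lemma openin_hyper:
  "openin (uniform_topology (hyperspace UNIV) hyper_uniformity) P \<longleftrightarrow>
    P \<subseteq> hyperspace UNIV \<and> (\<forall>A\<in>P. \<exists>U\<in>entourages. hyper_ent UNIV U `` {A} \<subseteq> P)"
proof -
  have "E \<subseteq> hyperspace UNIV \<times> hyperspace UNIV" if "E \<in> hyper_ent UNIV ` entourages" for E :: "('a set \<times> 'a set) set"
    using that by (auto simp: hyper_ent_def)
  moreover have "\<exists>G\<in>hyper_ent UNIV ` entourages. G \<subseteq> E \<inter> F" if "E \<in> hyper_ent UNIV ` entourages" "F \<in> hyper_ent UNIV ` entourages" for E F
    by (rule directed_image_entourages[OF _ that]) (rule hyper_ent_mono)
  ultimately have "openin (uniform_topology (hyperspace UNIV) (uniformity_of_base (hyperspace UNIV) (hyper_ent UNIV ` entourages))) P \<longleftrightarrow>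
      P \<subseteq> hyperspace UNIV \<and> (\<forall>x\<in>P. \<exists>E\<in>hyper_ent UNIV ` entourages. E `` {x} \<subseteq> P)"
    by (intro openin_uniform_topology_base)
  then show ?thesis unfolding hyper_uniformity_def by simp
qed

lemma openin_level:
  "openin (uniform_topology fuzzy_space level_uniformity) P \<longleftrightarrow>
    P \<subseteq> fuzzy_space \<and> (\<forall>u\<in>P. \<exists>U\<in>entourages. level_ent U `` {u} \<subseteq> P)"
proof -
  have "E \<subseteq> fuzzy_space \<times> fuzzy_space" if "E \<in> level_ent ` entourages" for E :: "(('a \<Rightarrow> real) \<times> ('a \<Rightarrow> real)) set"
    using that by (auto simp: level_ent_def)
  moreover have "\<exists>G\<in>level_ent ` entourages. G \<subseteq> E \<inter> F" if "E \<in> level_ent ` entourages" "F \<in> level_ent ` entourages" for E F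
    by (rule directed_image_entourages[OF _ that]) (rule level_ent_mono)
  ultimately have "openin (uniform_topology fuzzy_space (uniformity_of_base fuzzy_space (level_ent ` entourages))) P \<longleftrightarrow>
      P \<subseteq> fuzzy_space \<and> (\<forall>x\<in>P. \<exists>E\<in>level_ent ` entourages. E `` {x} \<subseteq> P)"
    by (intro openin_uniform_topology_base)
  then show ?thesis unfolding level_uniformity_def by simp
qed

lemma openin_skorokhod:
  "openin (uniform_topology fuzzy_space skorokhod_uniformity) P \<longleftrightarrow>
    P \<subseteq> fuzzy_space \<and> (\<forall>u\<in>P. \<exists>U\<in>entourages. \<exists>\<epsilon>>0. skorokhod_ent U \<epsilon> `` {u} \<subseteq> P)"
proof -
  let ?B = "{skorokhod_ent U \<epsilon> |U \<epsilon>. U \<in> entourages \<and> \<epsilon> > 0} :: (('a \<Rightarrow> real) \<times> ('a \<Rightarrow> real)) set set"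
  have "E \<subseteq> fuzzy_space \<times> fuzzy_space" if "E \<in> ?B"
    for E :: "(('a \<Rightarrow> real) \<times> ('a \<Rightarrow> real)) set"
    using that by (auto simp: skorokhod_ent_def)
  moreover have "\<exists>G\<in>?B. G \<subseteq> E \<inter> F" if "E \<in> ?B" "F \<in> ?B" for E F
    by (rule directed_image2_entourages[OF _ that]) (rule skorokhod_ent_mono)
  ultimately have *: "openin (uniform_topology fuzzy_space (uniformity_of_base fuzzy_space ?B)) P \<longleftrightarrow>
      P \<subseteq> fuzzy_space \<and> (\<forall>u\<in>P. \<exists>E\<in>?B. E `` {u} \<subseteq> P)"
    by (intro openin_uniform_topology_base)
  have bex: "(\<exists>E\<in>?B. Q E) \<longleftrightarrow>
      (\<exists>U\<in>entourages. \<exists>\<epsilon>>0. Q (skorokhod_ent U \<epsilon>))" for Q :: "(('a \<Rightarrow> real) \<times> ('a \<Rightarrow> real)) set \<Rightarrow> bool"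
    by blast
  show ?thesis unfolding skorokhod_uniformity_def using * unfolding bex .
qed

lemma openin_sendograph:
  "openin (uniform_topology fuzzy_space sendograph_uniformity) P \<longleftrightarrow>
    P \<subseteq> fuzzy_space \<and> (\<forall>u\<in>P. \<exists>U\<in>entourages. \<exists>\<epsilon>>0. sendograph_ent U \<epsilon> `` {u} \<subseteq> P)"
proof -
  let ?B = "{sendograph_ent U \<epsilon> |U \<epsilon>. U \<in> entourages \<and> \<epsilon> > 0} :: (('a \<Rightarrow> real) \<times> ('a \<Rightarrow> real)) set set"
  have "E \<subseteq> fuzzy_space \<times> fuzzy_space" if "E \<in> ?B"
    for E :: "(('a \<Rightarrow> real) \<times> ('a \<Rightarrow> real)) set"
    using that by (auto simp: sendograph_ent_def)
  moreover have "\<exists>G\<in>?B. G \<subseteq> E \<inter> F" if "E \<in> ?B" "F \<in> ?B" for E F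
    by (rule directed_image2_entourages[OF _ that]) (rule sendograph_ent_mono)
  ultimately have *: "openin (uniform_topology fuzzy_space (uniformity_of_base fuzzy_space ?B)) P \<longleftrightarrow>
      P \<subseteq> fuzzy_space \<and> (\<forall>u\<in>P. \<exists>E\<in>?B. E `` {u} \<subseteq> P)"
    by (intro openin_uniform_topology_base)
  have bex: "(\<exists>E\<in>?B. Q E) \<longleftrightarrow>
      (\<exists>U\<in>entourages. \<exists>\<epsilon>>0. Q (sendograph_ent U \<epsilon>))" for Q :: "(('a \<Rightarrow> real) \<times> ('a \<Rightarrow> real)) set \<Rightarrow> bool"
    by blast
  show ?thesis unfolding sendograph_uniformity_def using * unfolding bex .
qed

lemma topspace_hyper: "topspace (uniform_topology (hyperspace UNIV) hyper_uniformity) = hyperspace UNIV"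
proof (rule antisym)
  show "topspace (uniform_topology (hyperspace UNIV) hyper_uniformity) \<subseteq> hyperspace UNIV"
    using openin_hyper[THEN iffD1, OF openin_topspace] by (rule conjunct1)
  have "openin (uniform_topology (hyperspace UNIV) hyper_uniformity) (hyperspace UNIV)"
    unfolding openin_hyper using UNIV_entourages by (auto simp: hyper_ent_def)
  then show "hyperspace UNIV \<subseteq> topspace (uniform_topology (hyperspace UNIV) hyper_uniformity)"
    by (rule openin_subset)
qed

lemma topspace_level: "topspace (uniform_topology fuzzy_space level_uniformity) = fuzzy_space"
proof (rule antisym)
  show "topspace (uniform_topology fuzzy_space level_uniformity) \<subseteq> fuzzy_space"
    using openin_level[THEN iffD1, OF openin_topspace] by (rule conjunct1)
  have "openin (uniform_topology fuzzy_space level_uniformity) fuzzy_space"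
    unfolding openin_level using UNIV_entourages by (auto simp: level_ent_def)
  then show "fuzzy_space \<subseteq> topspace (uniform_topology fuzzy_space level_uniformity)"
    by (rule openin_subset)
qed

lemma topspace_skorokhod: "topspace (uniform_topology fuzzy_space skorokhod_uniformity) = fuzzy_space"
proof (rule antisym)
  show "topspace (uniform_topology fuzzy_space skorokhod_uniformity) \<subseteq> fuzzy_space"
    using openin_skorokhod[THEN iffD1, OF openin_topspace] by (rule conjunct1)
  have "openin (uniform_topology fuzzy_space skorokhod_uniformity) fuzzy_space"
    unfolding openin_skorokhod
    by (intro conjI ballI order_refl bexI[OF _ UNIV_entourages] exI[of _ 1]) (auto simp: skorokhod_ent_def)
  then show "fuzzy_space \<subseteq> topspace (uniform_topology fuzzy_space skorokhod_uniformity)"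
    by (rule openin_subset)
qed

lemma topspace_sendograph: "topspace (uniform_topology fuzzy_space sendograph_uniformity) = fuzzy_space"
proof (rule antisym)
  show "topspace (uniform_topology fuzzy_space sendograph_uniformity) \<subseteq> fuzzy_space"
    using openin_sendograph[THEN iffD1, OF openin_topspace] by (rule conjunct1)
  have "openin (uniform_topology fuzzy_space sendograph_uniformity) fuzzy_space"
    unfolding openin_sendograph
    by (intro conjI ballI order_refl bexI[OF _ UNIV_entourages] exI[of _ 1]) (auto simp: sendograph_ent_def)
  then show "fuzzy_space \<subseteq> topspace (uniform_topology fuzzy_space sendograph_uniformity)"
    by (rule openin_subset)
qed

end

theory Submission
  imports Defs
begin

text \<open>Level-wise transitivity passes to the two coarser uniformities, and from each of these to the
  hyperspace, because \<^term>\<open>fuzzy_supp\<close> is a factor map. Transitivity on the hyperspace, applied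
  to the compact sets inside \<open>A\<close> and the compact sets meeting both \<open>B\<close> and \<open>C\<close>, gives Petersen's
  criterion for weak mixing. Conversely, a fuzzy set is level-wise close to one with finite support
  whose points may be moved within small open sets, so weak mixing yields level-wise transitivity.\<close>

section \<open>Entourages\<close>

text \<open>Two facts shape the argument. An upper semicontinuous function is bounded near a point
  only from above, so a finite approximation cannot use sampled values as heights: each small open
  set receives the maximum of \<open>u\<close> over the part of the support in its closure. And
  level 0, being a closure, behaves unlike the positive levels. \<open>zadeh\<close> is therefore
  analysed at positive levels, where its supremum is attained in the fibre, and supports are then
  treated by closure arguments. In the passage to the hyperspace level 0 is the helpful one: a time
  change may shift intermediate cuts but fixes 0, and the bottom slice of a sendograph is the whole
  support.\<close>

lemma entourage_refl: "U \<in> entourages \<Longrightarrow> (x, x) \<in> U"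
  unfolding entourages_def using uniformity_refl by fastforce

lemma entourage_converse:
  assumes "U \<in> entourages"
  shows "U\<inverse> \<in> entourages"
proof -
  have "eventually (\<lambda>p. p \<in> U) uniformity"
    using assms by (simp add: entourages_def)
  from uniformity_sym[OF this] show ?thesis
    by (auto simp: entourages_def case_prod_unfold elim: eventually_mono)
qed

lemma entourage_half:
  assumes "U \<in> entourages"
  obtains V where "V \<in> entourages" "V O V \<subseteq> U"
proof -
  have "eventually (\<lambda>p. p \<in> U) uniformity"
    using assms by (simp add: entourages_def)
  then obtain D where D: "eventually D uniformity"
    "\<And>x y z. D (x, y) \<Longrightarrow> D (y, z) \<Longrightarrow> (x, z) \<in> U"
    by (erule uniformity_transE)
  have "Collect D \<in> entourages"
    using D(1) by (simp add: entourages_def)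
  moreover have "Collect D O Collect D \<subseteq> U"
    using D(2) by auto
  ultimately show thesis by (rule that)
qed

lemma entourage_half_sym:
  assumes "U \<in> entourages"
  obtains V where "V \<in> entourages" "sym V" "V \<subseteq> U" "V O V \<subseteq> U"
proof -
  obtain W where W: "W \<in> entourages" "W O W \<subseteq> U"
    using assms by (rule entourage_half)
  let ?V = "W \<inter> W\<inverse>"
  have "?V \<in> entourages"
    using W(1) by (intro Int_entourages entourage_converse)
  moreover have "sym ?V" by (auto simp: sym_def)
  moreover have "?V \<subseteq> U"
  proof
    fix p assume "p \<in> ?V"
    then have "(fst p, snd p) \<in> W O W"
      using entourage_refl[OF W(1)] by (auto intro!: relcompI)
    then show "p \<in> U" using W(2) by auto
  qed
  moreover have "?V O ?V \<subseteq> U" using W(2) by blast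
  ultimately show thesis by (rule that)
qed

lemma entourage_open_nhd:
  assumes "U \<in> entourages"
  obtains N where "open N" "x \<in> N" "N \<subseteq> U `` {x}"
proof -
  \<comment> \<open>Entourages need not be open, so the neighbourhood of \<open>x\<close> given by
    \<open>U\<close> is replaced by its interior; halving shows that this interior is open.\<close>
  let ?N = "{y. \<exists>V\<in>entourages. V `` {y} \<subseteq> U `` {x}}"
  have "open ?N"
    unfolding open_iff_entourages
  proof (intro ballI)
    fix y assume "y \<in> ?N"
    then obtain V where V: "V \<in> entourages" "V `` {y} \<subseteq> U `` {x}" by blast
    obtain W where W: "W \<in> entourages" "W O W \<subseteq> V"
      using V(1) by (rule entourage_half)
    have "W `` {y} \<subseteq> ?N"
    proof
      fix z assume "z \<in> W `` {y}"
      then have "W `` {z} \<subseteq> U `` {x}" using W(2) V(2) by blast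
      then show "z \<in> ?N" using W(1) by blast
    qed
    then show "\<exists>V\<in>entourages. V `` {y} \<subseteq> ?N" using W(1) by blast
  qed
  moreover have "x \<in> ?N" using assms by blast
  moreover have "?N \<subseteq> U `` {x}" using entourage_refl by blast
  ultimately show thesis by (rule that)
qed

lemma closure_entourage:
  assumes "U \<in> entourages" "x \<in> closure A"
  obtains y where "y \<in> A" "(x, y) \<in> U"
proof -
  obtain N where N: "open N" "x \<in> N" "N \<subseteq> U `` {x}"
    using assms(1) by (rule entourage_open_nhd)
  then have "N \<inter> A \<noteq> {}"
    using assms(2) open_Int_closure_eq_empty[of N A] by blast
  then show thesis using N(3) that by blast
qed

text \<open>A Lebesgue number argument: \<open>N x\<close> is within one \<open>V x\<close>-step of
  \<open>x\<close>, so a further \<open>V x\<close>-step stays in \<open>G\<close>, and finitely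
  many \<open>V x\<close> intersect in an entourage. It makes the compact sets inside an open set a
  Vietoris-open family.\<close>

lemma compact_subset_open_entourage:
  assumes "compact K" "open G" "K \<subseteq> G"
  obtains U where "U \<in> entourages" "U `` K \<subseteq> G"
proof -
  have "\<forall>x\<in>K. \<exists>V N. V \<in> entourages \<and> open N \<and> x \<in> N \<and> V `` N \<subseteq> G"
  proof
    fix x assume "x \<in> K"
    then obtain U where U: "U \<in> entourages" "U `` {x} \<subseteq> G"
      using assms(2,3) unfolding open_iff_entourages by blast
    obtain V where V: "V \<in> entourages" "V O V \<subseteq> U"
      using U(1) by (rule entourage_half)
    obtain N where "open N" "x \<in> N" "N \<subseteq> V `` {x}"
      using V(1) by (rule entourage_open_nhd)
    moreover from this have "V `` N \<subseteq> G" using V(2) U(2) by blast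
    ultimately show "\<exists>V N. V \<in> entourages \<and> open N \<and> x \<in> N \<and> V `` N \<subseteq> G"
      using V(1) by blast
  qed
  then obtain V N where VN: "\<And>x. x \<in> K \<Longrightarrow> V x \<in> entourages \<and> open (N x) \<and> x \<in> N x \<and> V x `` N x \<subseteq> G"
    by metis
  obtain F where F: "F \<subseteq> K" "finite F" "K \<subseteq> (\<Union>x\<in>F. N x)"
    using assms(1) by (rule compactE_image[of K K N]) (use VN in auto)
  have "(\<Inter>x\<in>F. V x) \<in> entourages"
    using F(2,1)
  proof (induction F rule: finite_induct)
    case empty
    show ?case using UNIV_entourages by simp
  next
    case (insert x F)
    then show ?case using VN by (simp add: Int_entourages)
  qed
  moreover have "(\<Inter>x\<in>F. V x) `` K \<subseteq> G"
  proof
    fix y assume "y \<in> (\<Inter>x\<in>F. V x) `` K"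
    then obtain z where z: "z \<in> K" "\<And>x. x \<in> F \<Longrightarrow> (z, y) \<in> V x" by blast
    then obtain x where "x \<in> F" "z \<in> N x" using F(3) by blast
    then have "y \<in> V x `` N x" using z by blast
    then show "y \<in> G" using VN \<open>x \<in> F\<close> F(1) by blast
  qed
  ultimately show thesis by (rule that)
qed

text \<open>The separation hypothesis enters only here; afterwards it acts through the closedness of
  compact sets.\<close>

lemma separated_Hausdorff:
  assumes "separated_uniformity TYPE('a::uniform_space)"
  shows "Hausdorff_space (euclidean :: 'a topology)"
  unfolding Hausdorff_space_def
proof (intro allI impI)
  fix x y :: 'a
  assume "x \<in> topspace euclidean \<and> y \<in> topspace euclidean \<and> x \<noteq> y"
  then have "(x, y) \<notin> \<Inter>entourages"
    using assms by (simp add: separated_uniformity_def)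
  then obtain U where U: "U \<in> entourages" "(x, y) \<notin> U" by blast
  obtain V where V: "V \<in> entourages" "sym V" "V O V \<subseteq> U"
    using U(1) by (rule entourage_half_sym)
  obtain M where M: "open M" "x \<in> M" "M \<subseteq> V `` {x}"
    using V(1) by (rule entourage_open_nhd)
  obtain N where N: "open N" "y \<in> N" "N \<subseteq> V `` {y}"
    using V(1) by (rule entourage_open_nhd)
  have "disjnt M N"
    unfolding disjnt_iff
  proof clarify
    fix z assume "z \<in> M" "z \<in> N"
    then have "(x, z) \<in> V" "(z, y) \<in> V"
      using M(3) N(3) V(2) by (auto dest: symD)
    then show False using V(3) U(2) by blast
  qed
  then show "\<exists>U V. openin euclidean U \<and> openin euclidean V \<and> x \<in> U \<and> y \<in> V \<and> disjnt U V"
    using M N by auto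
qed

lemma Hausdorff_compact_closed:
  assumes "Hausdorff_space (euclidean :: 'a::topological_space topology)" "compact (K :: 'a set)"
  shows "closed K"
  using compactin_imp_closedin[OF assms(1), of K] assms(2) by simp

section \<open>Transitivity and weak mixing\<close>

text \<open>Preimages of non-empty open sets under a continuous surjection are open and non-empty,
  and orbits project to orbits. With the identity as \<open>h\<close> this is the passage to a
  coarser topology, with \<open>fuzzy_supp\<close> the passage to the hyperspace.\<close>

lemma transitive_map_factor:
  assumes "transitive_map T g" "continuous_map T T' h" "topspace T' \<subseteq> h ` topspace T"
    and g: "\<And>x. x \<in> topspace T \<Longrightarrow> g x \<in> topspace T"
    and hg: "\<And>x. x \<in> topspace T \<Longrightarrow> h (g x) = g' (h x)"
  shows "transitive_map T' g'"
  unfolding transitive_map_def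
proof (intro allI impI)
  fix P Q assume PQ: "openin T' P \<and> P \<noteq> {} \<and> openin T' Q \<and> Q \<noteq> {}"
  let ?pre = "\<lambda>P. {x \<in> topspace T. h x \<in> P}"
  have iter: "(g ^^ n) x \<in> topspace T \<and> h ((g ^^ n) x) = (g' ^^ n) (h x)" if "x \<in> topspace T" for n x
    by (induction n) (use that g hg in auto)
  have "openin T (?pre R) \<and> ?pre R \<noteq> {}" if R: "openin T' R \<and> R \<noteq> {}" for R
  proof
    show "openin T (?pre R)" using R assms(2) by (intro openin_continuous_map_preimage) auto
    obtain y where "y \<in> R" using R by blast
    moreover from this have "y \<in> topspace T'" using R openin_subset by blast
    ultimately show "?pre R \<noteq> {}" using assms(3) by blast
  qed
  then obtain n where n: "n \<ge> 1" "(g ^^ n) ` ?pre P \<inter> ?pre Q \<noteq> {}"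
    using assms(1)[unfolded transitive_map_def, rule_format, of "?pre P" "?pre Q"] PQ by auto
  then obtain x where "x \<in> topspace T" "h x \<in> P" "h ((g ^^ n) x) \<in> Q" by blast
  then have "(g' ^^ n) (h x) \<in> (g' ^^ n) ` P \<inter> Q" using iter by auto
  then show "\<exists>n\<ge>1. (g' ^^ n) ` P \<inter> Q \<noteq> {}" using n(1) by blast
qed

section \<open>Weak mixing in terms of hitting times\<close>

lemma map_prod_funpow:
  fixes f :: "'a \<Rightarrow> 'a" and g :: "'b \<Rightarrow> 'b"
  shows "map_prod f g ^^ n = map_prod (f ^^ n) (g ^^ n)"
  by (induction n) (auto simp: fun_eq_iff)

lemma image_funpow:
  fixes f :: "'a \<Rightarrow> 'a"
  shows "image f ^^ n = image (f ^^ n)"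
  by (induction n) (auto simp: fun_eq_iff image_comp)

text \<open>Open boxes form a base of the product topology, so transitivity of the product map need
  only be tested on them.\<close>

lemma weakly_mixing_iff:
  fixes f :: "'a::topological_space \<Rightarrow> 'a"
  shows "weakly_mixing_map euclidean f \<longleftrightarrow>
    (\<forall>A B C D. open A \<and> A \<noteq> {} \<and> open B \<and> B \<noteq> {} \<and> open C \<and> C \<noteq> {} \<and> open D \<and> D \<noteq> {} \<longrightarrow>
      (\<exists>n\<ge>1. (f ^^ n) ` A \<inter> B \<noteq> {} \<and> (f ^^ n) ` C \<inter> D \<noteq> {}))"
    (is "?L \<longleftrightarrow> ?R")
proof
  assume L: ?L
  show ?R
  proof (intro allI impI)
    fix A B C D :: "'a set"
    assume *: "open A \<and> A \<noteq> {} \<and> open B \<and> B \<noteq> {} \<and> open C \<and> C \<noteq> {} \<and> open D \<and> D \<noteq> {}"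
    then have "open (A \<times> C) \<and> A \<times> C \<noteq> {} \<and> open (B \<times> D) \<and> B \<times> D \<noteq> {}"
      by (simp add: open_Times)
    then have "\<exists>n\<ge>1. (map_prod f f ^^ n) ` (A \<times> C) \<inter> (B \<times> D) \<noteq> {}"
      using L by (simp add: weakly_mixing_map_def transitive_map_def)
    then obtain n x y where n: "n \<ge> 1" "x \<in> A" "y \<in> C" "(f ^^ n) x \<in> B" "(f ^^ n) y \<in> D"
      unfolding map_prod_funpow by auto
    then have "(f ^^ n) x \<in> (f ^^ n) ` A \<inter> B" "(f ^^ n) y \<in> (f ^^ n) ` C \<inter> D"
      by simp_all
    then have "(f ^^ n) ` A \<inter> B \<noteq> {}" "(f ^^ n) ` C \<inter> D \<noteq> {}" by (metis empty_iff)+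
    with n(1) show "\<exists>n\<ge>1. (f ^^ n) ` A \<inter> B \<noteq> {} \<and> (f ^^ n) ` C \<inter> D \<noteq> {}"
      by (intro exI[of _ n] conjI)
  qed
next
  assume R: ?R
  have "\<exists>n\<ge>1. (map_prod f f ^^ n) ` P \<inter> Q \<noteq> {}"
    if "open P" "P \<noteq> {}" "open Q" "Q \<noteq> {}" for P Q :: "('a \<times> 'a) set"
  proof -
    obtain p q where p: "p \<in> P" and q: "q \<in> Q" using \<open>P \<noteq> {}\<close> \<open>Q \<noteq> {}\<close> by blast
    obtain A C where AC: "open A" "open C" "p \<in> A \<times> C" "A \<times> C \<subseteq> P"
      using \<open>open P\<close> p by (rule open_prod_elim)
    obtain B D where BD: "open B" "open D" "q \<in> B \<times> D" "B \<times> D \<subseteq> Q"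
      using \<open>open Q\<close> q by (rule open_prod_elim)
    have "A \<noteq> {}" "B \<noteq> {}" "C \<noteq> {}" "D \<noteq> {}" using AC(3) BD(3) by auto
    then have "\<exists>n\<ge>1. (f ^^ n) ` A \<inter> B \<noteq> {} \<and> (f ^^ n) ` C \<inter> D \<noteq> {}"
      using R[rule_format, of A B C D] AC(1,2) BD(1,2) by simp
    then obtain n a c where n: "n \<ge> 1" "a \<in> A" "(f ^^ n) a \<in> B" "c \<in> C" "(f ^^ n) c \<in> D" by blast
    have "(a, c) \<in> P" using AC(4) n(2,4) by (rule subsetD[OF _ SigmaI])
    moreover have "((f ^^ n) a, (f ^^ n) c) \<in> Q" using BD(4) n(3,5) by (rule subsetD[OF _ SigmaI])
    then have "(map_prod f f ^^ n) (a, c) \<in> Q" by (simp add: map_prod_funpow)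
    ultimately have "(map_prod f f ^^ n) ` P \<inter> Q \<noteq> {}" by (metis IntI empty_iff imageI)
    with n(1) show ?thesis by (intro exI[of _ n] conjI)
  qed
  then show ?L by (simp add: weakly_mixing_map_def transitive_map_def)
qed

lemma continuous_on_funpow:
  fixes f :: "'a::topological_space \<Rightarrow> 'a"
  assumes "continuous_on UNIV f"
  shows "continuous_on UNIV (f ^^ n)"
proof (induction n)
  case 0
  show ?case by (simp add: id_def)
next
  case (Suc n)
  have "continuous_on ((f ^^ n) ` UNIV) f"
    using assms by (rule continuous_on_subset) simp
  with Suc have "continuous_on UNIV (f \<circ> f ^^ n)" by (rule continuous_on_compose)
  then show ?case by simp
qed

lemma open_funpow_vimage:
  fixes f :: "'a::topological_space \<Rightarrow> 'a"
  assumes "continuous_on UNIV f" "open B"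
  shows "open ((f ^^ n) -` B)"
  using assms(2) continuous_on_funpow[OF assms(1)] by (rule open_vimage)

text \<open>Petersen's criterion: it suffices to hit two targets from a single open set.\<close>

lemma weakly_mixingI:
  fixes f :: "'a::topological_space \<Rightarrow> 'a"
  assumes cont: "continuous_on UNIV f"
    and hit: "\<And>A B C. open A \<Longrightarrow> A \<noteq> {} \<Longrightarrow> open B \<Longrightarrow> B \<noteq> {} \<Longrightarrow> open C \<Longrightarrow> C \<noteq> {} \<Longrightarrow>
      \<exists>n\<ge>1. (f ^^ n) ` A \<inter> B \<noteq> {} \<and> (f ^^ n) ` A \<inter> C \<noteq> {}"
  shows "weakly_mixing_map euclidean f"
  unfolding weakly_mixing_iff
proof (intro allI impI)
  fix A B C D :: "'a set"
  assume *: "open A \<and> A \<noteq> {} \<and> open B \<and> B \<noteq> {} \<and> open C \<and> C \<noteq> {} \<and> open D \<and> D \<noteq> {}"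
  obtain n where n: "(f ^^ n) ` A \<inter> C \<noteq> {}" "(f ^^ n) ` A \<inter> D \<noteq> {}"
    using hit[of A C D] * by blast
  \<comment> \<open>The time \<open>n\<close> ties \<open>C\<close> to \<open>D\<close>: if
    \<open>f ^^ k\<close> sends a point of this set into the preimage of \<open>D\<close> under
    \<open>f ^^ n\<close>, then, as iterates commute, the \<open>n\<close>-th iterate of the point
    lies in \<open>C\<close> and is sent into \<open>D\<close> by \<open>f ^^ k\<close>. One
    \<open>k\<close> then serves both pairs.\<close>
  let ?W = "A \<inter> (f ^^ n) -` C"
  have "open ?W" "?W \<noteq> {}" "open ((f ^^ n) -` D)" "(f ^^ n) -` D \<noteq> {}"
    using * n open_funpow_vimage[OF cont, of C n] open_funpow_vimage[OF cont, of D n] by blast+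
  then obtain k where k: "k \<ge> 1" "(f ^^ k) ` ?W \<inter> B \<noteq> {}" "(f ^^ k) ` ?W \<inter> (f ^^ n) -` D \<noteq> {}"
    using hit[of ?W B "(f ^^ n) -` D"] * by blast
  then obtain x where x: "(f ^^ n) x \<in> C" "(f ^^ n) ((f ^^ k) x) \<in> D" by blast
  have "(f ^^ n) ((f ^^ k) x) = (f ^^ k) ((f ^^ n) x)"
    by (simp add: funpow_add[unfolded o_def, THEN fun_cong, symmetric] add.commute)
  then have "(f ^^ k) ` C \<inter> D \<noteq> {}" using x by auto
  moreover have "(f ^^ k) ` A \<inter> B \<noteq> {}" using k(2) by blast
  ultimately show "\<exists>n\<ge>1. (f ^^ n) ` A \<inter> B \<noteq> {} \<and> (f ^^ n) ` C \<inter> D \<noteq> {}"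
    using k(1) by blast
qed

text \<open>Furstenberg's intersection lemma: the sets of hitting times of a weakly mixing map
  form a filter base.\<close>

lemma weakly_mixing_finite:
  fixes f :: "'a::topological_space \<Rightarrow> 'a"
  assumes cont: "continuous_on UNIV f" and wm: "weakly_mixing_map euclidean f"
    and "finite S" "\<And>A B. (A, B) \<in> S \<Longrightarrow> open A \<and> A \<noteq> {} \<and> open B \<and> B \<noteq> {}"
  obtains n where "n \<ge> 1" "\<And>A B. (A, B) \<in> S \<Longrightarrow> (f ^^ n) ` A \<inter> B \<noteq> {}"
proof -
  define hits where "hits A B = {n. (f ^^ n) ` A \<inter> B \<noteq> {}}" for A B :: "'a set"
  have wm: "\<exists>n\<ge>1. n \<in> hits A B \<inter> hits C D"
    if "open A" "A \<noteq> {}" "open B" "B \<noteq> {}" "open C" "C \<noteq> {}" "open D" "D \<noteq> {}" for A B C D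
    using wm[unfolded weakly_mixing_iff, rule_format, of A B C D] that by (simp add: hits_def)
  have "\<exists>A B. open A \<and> A \<noteq> {} \<and> open B \<and> B \<noteq> {} \<and> hits A B \<subseteq> (\<Inter>p\<in>S. hits (fst p) (snd p))"
    using assms(3,4)
  proof (induction S rule: finite_induct)
    case empty
    show ?case by (intro exI[of _ UNIV]) simp
  next
    case (insert p S)
    obtain C D where p: "p = (C, D)" by (rule prod.exhaust)
    have CD: "open C" "C \<noteq> {}" "open D" "D \<noteq> {}" using insert.prems[of C D] p by simp_all
    have "\<exists>A B. open A \<and> A \<noteq> {} \<and> open B \<and> B \<noteq> {} \<and> hits A B \<subseteq> (\<Inter>p\<in>S. hits (fst p) (snd p))"
      by (rule insert.IH) (rule insert.prems, simp)
    then obtain A B where AB: "open A" "A \<noteq> {}" "open B" "B \<noteq> {}"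
      and sub: "hits A B \<subseteq> (\<Inter>p\<in>S. hits (fst p) (snd p))"
      by (elim exE conjE)
    \<comment> \<open>The pairing is crosswise: \<open>A\<close> with \<open>C\<close> and
      \<open>B\<close> with \<open>D\<close>. A time leading from \<open>?A\<close> to
      \<open>?B\<close> then leads from \<open>A\<close> to \<open>B\<close> and, after shifting by
      \<open>k\<close>, from \<open>C\<close> to \<open>D\<close>.\<close>
    obtain k where k: "k \<in> hits A C" "k \<in> hits B D"
      using wm[OF AB(1,2) CD(1,2) AB(3,4) CD(3,4)] by blast
    let ?A = "A \<inter> (f ^^ k) -` C" and ?B = "B \<inter> (f ^^ k) -` D"
    have "open ?A" "open ?B"
      using AB CD by (simp_all add: open_Int open_funpow_vimage[OF cont])
    moreover have "?A \<noteq> {}" "?B \<noteq> {}" using k unfolding hits_def by blast+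
    moreover have "n \<in> hits A B \<inter> hits C D" if "n \<in> hits ?A ?B" for n
    proof -
      obtain x where x: "x \<in> A" "(f ^^ k) x \<in> C" "(f ^^ n) x \<in> B" "(f ^^ k) ((f ^^ n) x) \<in> D"
        using \<open>n \<in> hits ?A ?B\<close> unfolding hits_def by blast
      have "(f ^^ k) ((f ^^ n) x) = (f ^^ n) ((f ^^ k) x)"
        by (simp add: funpow_add[unfolded o_def, THEN fun_cong, symmetric] add.commute)
      with x(4) have "(f ^^ n) ((f ^^ k) x) \<in> D" by simp
      with x show ?thesis unfolding hits_def by blast
    qed
    then have "hits ?A ?B \<subseteq> (\<Inter>p\<in>insert p S. hits (fst p) (snd p))"
      using sub p by auto
    ultimately show ?case by (intro exI[of _ ?A] exI[of _ ?B] conjI)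
  qed
  then obtain A B where AB: "open A" "A \<noteq> {}" "open B" "B \<noteq> {}"
    and sub: "hits A B \<subseteq> (\<Inter>p\<in>S. hits (fst p) (snd p))"
    by (elim exE conjE)
  obtain n where n: "n \<ge> 1" "n \<in> hits A B"
    using wm[OF AB AB] by blast
  show thesis
  proof (rule that[OF n(1)])
    fix A B assume "(A, B) \<in> S"
    then have "n \<in> hits A B" using sub n(2) by force
    then show "(f ^^ n) ` A \<inter> B \<noteq> {}" by (simp add: hits_def)
  qed
qed

section \<open>Fuzzy sets and Zadeh's extension\<close>

text \<open>Without a maximum the open sets where \<open>u\<close> is below \<open>u y\<close>, for
  \<open>y\<close> in \<open>K\<close>, would cover \<open>K\<close>; a point with the largest value
  in a finite subcover is then not covered.\<close>

lemma upper_semicont_attains_max: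
  assumes "compact K" "K \<noteq> {}" "upper_semicont u"
  obtains z where "z \<in> K" "\<And>y. y \<in> K \<Longrightarrow> u y \<le> u z"
proof -
  have "\<exists>z\<in>K. \<forall>y\<in>K. u y \<le> u z"
  proof (rule ccontr)
    assume "\<not> ?thesis"
    then have cover: "K \<subseteq> (\<Union>y\<in>K. {x. u x < u y})" by (force simp: not_le)
    have "open {x. u x < u y}" for y using assms(3) by (simp add: upper_semicont_def)
    then obtain F where F: "F \<subseteq> K" "finite F" "K \<subseteq> (\<Union>y\<in>F. {x. u x < u y})"
      using compactE_image[OF assms(1) _ cover] by metis
    have "F \<noteq> {}" using F(3) assms(2) by blast
    then have "Max (u ` F) \<in> u ` F" using F(2) by simp
    then obtain y where y: "y \<in> F" "u y = Max (u ` F)" by auto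
    then obtain y' where "y' \<in> F" "u y < u y'" using F by blast
    moreover have "u y' \<le> Max (u ` F)" using F(2) \<open>y' \<in> F\<close> by simp
    ultimately show False using y(2) by simp
  qed
  then show thesis using that by blast
qed

lemma fuzzy_spaceD:
  assumes "u \<in> fuzzy_space"
  shows "0 \<le> u x" "u x \<le> 1" "\<exists>x. u x = 1" "upper_semicont u" "compact (fuzzy_supp u)"
  using assms by (auto simp: fuzzy_space_def)

lemma pos_in_fuzzy_supp: "0 < u x \<Longrightarrow> x \<in> fuzzy_supp u"
  unfolding fuzzy_supp_def using closure_subset[of "{x. 0 < u x}"] by (rule subsetD) simp

lemma upper_semicont_closed: "upper_semicont u \<Longrightarrow> closed {x. c \<le> u x}"
  by (simp add: upper_semicont_def closed_def Collect_neg_eq[symmetric] not_le)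

lemma fuzzy_supp_hyperspace:
  assumes "u \<in> fuzzy_space"
  shows "fuzzy_supp u \<in> hyperspace UNIV"
proof -
  obtain x where "u x = 1" using fuzzy_spaceD(3)[OF assms] by blast
  then have "x \<in> fuzzy_supp u" by (intro pos_in_fuzzy_supp) simp
  then show ?thesis using fuzzy_spaceD(5)[OF assms] by (auto simp: hyperspace_def)
qed

lemma cut_hyperspace:
  assumes "u \<in> fuzzy_space" "\<alpha> \<in> {0..1}"
  shows "cut u \<alpha> \<in> hyperspace UNIV"
proof (cases "\<alpha> = 0")
  case True
  then show ?thesis using fuzzy_supp_hyperspace[OF assms(1)] by (simp add: cut_def)
next
  case False
  then have "fuzzy_supp u \<inter> {x. \<alpha> \<le> u x} = {x. \<alpha> \<le> u x}"
    using assms(2) by (auto intro!: pos_in_fuzzy_supp)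
  moreover have "compact (fuzzy_supp u \<inter> {x. \<alpha> \<le> u x})"
    by (intro compact_Int_closed upper_semicont_closed fuzzy_spaceD(4,5)[OF assms(1)])
  ultimately have "compact {x. \<alpha> \<le> u x}" by simp
  moreover obtain x where "u x = 1" using fuzzy_spaceD(3)[OF assms(1)] by blast
  then have "\<exists>x. \<alpha> \<le> u x" using assms(2) by (intro exI[of _ x]) simp
  ultimately show ?thesis using False by (auto simp: cut_def hyperspace_def)
qed

text \<open>The supremum is attained: points are closed, so the fibre meets the compact support in a
  compact set, which is non-empty when the supremum is positive. Level 0 is excluded because an
  empty fibre has value 0 and no witness.\<close>

lemma zadeh_ge_iff:
  fixes f :: "'a::topological_space \<Rightarrow> 'a"
  assumes T2: "Hausdorff_space (euclidean :: 'a topology)" and cont: "continuous_on UNIV f"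
    and u: "u \<in> fuzzy_space" and "0 < \<alpha>"
  shows "\<alpha> \<le> zadeh f u x \<longleftrightarrow> (\<exists>z. f z = x \<and> \<alpha> \<le> u z)"
proof
  have bdd: "bdd_above (u ` B)" for B
    using fuzzy_spaceD(2)[OF u] by (auto intro!: bdd_aboveI2)
  show "\<alpha> \<le> zadeh f u x" if ex: "\<exists>z. f z = x \<and> \<alpha> \<le> u z"
  proof -
    obtain z where z: "z \<in> f -` {x}" "\<alpha> \<le> u z" using ex by blast
    then have "zadeh f u x = (SUP z\<in>f -` {x}. u z)" by (auto simp: zadeh_def)
    moreover have "u z \<le> (SUP z\<in>f -` {x}. u z)" by (rule cSUP_upper[OF z(1) bdd])
    ultimately show ?thesis using z(2) by simp
  qed
  assume *: "\<alpha> \<le> zadeh f u x"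
  then have ne: "f -` {x} \<noteq> {}" and sup: "\<alpha> \<le> (SUP z\<in>f -` {x}. u z)"
    using \<open>0 < \<alpha>\<close> by (auto simp: zadeh_def split: if_splits)
  let ?K = "fuzzy_supp u \<inter> f -` {x}"
  have "closed {x}" using Hausdorff_compact_closed[OF T2] by simp
  then have "closed (f -` {x})"
    using cont by (rule closed_vimage)
  then have "compact ?K" using fuzzy_spaceD(5)[OF u] by (rule compact_Int_closed[rotated])
  moreover have "?K \<noteq> {}"
  proof
    assume "?K = {}"
    then have "u z \<le> 0" if "z \<in> f -` {x}" for z
      using that pos_in_fuzzy_supp[of u z] by (auto simp: not_less[symmetric])
    then have "(SUP z\<in>f -` {x}. u z) \<le> 0" by (intro cSUP_least[OF ne])
    then show False using sup \<open>0 < \<alpha>\<close> by simp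
  qed
  ultimately obtain z where z: "z \<in> ?K" "\<And>y. y \<in> ?K \<Longrightarrow> u y \<le> u z"
    using fuzzy_spaceD(4)[OF u] by (rule upper_semicont_attains_max) blast
  have "u y \<le> u z" if "y \<in> f -` {x}" for y
  proof (cases "0 < u y")
    case True
    then show ?thesis using z(2) pos_in_fuzzy_supp that by blast
  next
    case False
    then show ?thesis using fuzzy_spaceD(1)[OF u, of z] by linarith
  qed
  then have "(SUP z\<in>f -` {x}. u z) \<le> u z" by (intro cSUP_least[OF ne])
  then show "\<exists>z. f z = x \<and> \<alpha> \<le> u z" using sup z(1) by (intro exI[of _ z]) auto
qed

text \<open>Images commute with the closure here because the image of the compact support is compact
  and hence closed.\<close>

lemma fuzzy_supp_zadeh:
  fixes f :: "'a::topological_space \<Rightarrow> 'a"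
  assumes T2: "Hausdorff_space (euclidean :: 'a topology)" and cont: "continuous_on UNIV f"
    and u: "u \<in> fuzzy_space"
  shows "fuzzy_supp (zadeh f u) = f ` fuzzy_supp u"
proof -
  have pos: "{x. 0 < zadeh f u x} = f ` {x. 0 < u x}"
  proof safe
    fix x assume "0 < zadeh f u x"
    then obtain z where "f z = x" "zadeh f u x \<le> u z"
      using zadeh_ge_iff[OF T2 cont u, of "zadeh f u x" x] by auto
    moreover from this have "0 < u z" using \<open>0 < zadeh f u x\<close> by simp
    ultimately show "x \<in> f ` {x. 0 < u x}" by blast
  next
    fix z assume "0 < u z"
    then have "u z \<le> zadeh f u (f z)" using zadeh_ge_iff[OF T2 cont u] by blast
    then show "0 < zadeh f u (f z)" using \<open>0 < u z\<close> by simp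
  qed
  have cf: "continuous_on A f" for A using cont by (rule continuous_on_subset) simp
  have "closed (f ` fuzzy_supp u)"
    by (intro Hausdorff_compact_closed[OF T2] compact_continuous_image cf fuzzy_spaceD(5)[OF u])
  then have "closure (f ` {x. 0 < u x}) \<subseteq> f ` fuzzy_supp u"
    by (intro closure_minimal) (auto intro: pos_in_fuzzy_supp)
  moreover have "f ` fuzzy_supp u \<subseteq> closure (f ` {x. 0 < u x})"
    unfolding fuzzy_supp_def by (rule image_closure_subset[OF cf]) (auto simp: closure_subset[THEN subsetD])
  ultimately show ?thesis unfolding fuzzy_supp_def[of "zadeh f u"] pos by blast
qed

lemma zadeh_fuzzy_space:
  fixes f :: "'a::topological_space \<Rightarrow> 'a"
  assumes T2: "Hausdorff_space (euclidean :: 'a topology)" and cont: "continuous_on UNIV f"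
    and u: "u \<in> fuzzy_space"
  shows "zadeh f u \<in> fuzzy_space"
proof -
  note ge = zadeh_ge_iff[OF T2 cont u]
  have cf: "continuous_on A f" for A using cont by (rule continuous_on_subset) simp
  have nonneg: "0 \<le> zadeh f u x" for x
  proof (cases "f -` {x} = {}")
    case False
    then obtain z where z: "z \<in> f -` {x}" by blast
    have "0 \<le> u z" by (rule fuzzy_spaceD(1)[OF u])
    also have "u z \<le> (SUP z\<in>f -` {x}. u z)"
      by (rule cSUP_upper[OF z]) (use fuzzy_spaceD(2)[OF u] in \<open>auto intro!: bdd_aboveI2\<close>)
    finally show ?thesis using False by (simp add: zadeh_def)
  qed (simp add: zadeh_def)
  moreover have le1: "zadeh f u x \<le> 1" for x
  proof (cases "0 < zadeh f u x")
    case True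
    then obtain z where "zadeh f u x \<le> u z" using ge[OF True, of x] by auto
    then show ?thesis using fuzzy_spaceD(2)[OF u, of z] by simp
  qed simp
  moreover obtain z where "u z = 1" using fuzzy_spaceD(3)[OF u] by blast
  then have "zadeh f u (f z) = 1" using ge[of 1 "f z"] le1[of "f z"] by (auto intro!: antisym)
  moreover have "upper_semicont (zadeh f u)"
    unfolding upper_semicont_def
  proof
    fix c
    show "open {x. zadeh f u x < c}"
    proof (cases "0 < c")
      case False
      then have "\<not> zadeh f u x < c" for x using nonneg[of x] by simp
      then show ?thesis by simp
    next
      case c: True
      \<comment> \<open>The superlevel set of \<open>zadeh f u\<close> at \<open>c\<close> is the
        image of that of \<open>u\<close>, so compactness of the latter gives closedness of the
        former.\<close>
      have "compact (fuzzy_supp u \<inter> {z. c \<le> u z})"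
        by (intro compact_Int_closed upper_semicont_closed fuzzy_spaceD(4,5)[OF u])
      also have "fuzzy_supp u \<inter> {z. c \<le> u z} = {z. c \<le> u z}"
        using c by (auto intro!: pos_in_fuzzy_supp)
      finally have "closed (f ` {z. c \<le> u z})"
        by (intro Hausdorff_compact_closed[OF T2] compact_continuous_image cf)
      moreover have "{x. zadeh f u x < c} = - f ` {z. c \<le> u z}"
        using ge[OF c] by (auto simp: not_le[symmetric])
      ultimately show ?thesis by (simp add: open_Compl)
    qed
  qed
  moreover have "compact (fuzzy_supp (zadeh f u))"
    unfolding fuzzy_supp_zadeh[OF assms]
    by (intro compact_continuous_image cf fuzzy_spaceD(5)[OF u])
  ultimately show ?thesis unfolding fuzzy_space_def by auto
qed

text \<open>At positive levels iterating \<open>zadeh f\<close> amounts to extending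
  \<open>f ^^ n\<close>. Both claims go through one induction, since the level description of the
  next iterate requires the current one to be in \<open>fuzzy_space\<close>.\<close>

lemma zadeh_funpow:
  fixes f :: "'a::topological_space \<Rightarrow> 'a"
  assumes T2: "Hausdorff_space (euclidean :: 'a topology)" and cont: "continuous_on UNIV f"
    and u: "u \<in> fuzzy_space"
  shows "(zadeh f ^^ n) u \<in> fuzzy_space"
    and "0 < \<alpha> \<Longrightarrow> \<alpha> \<le> (zadeh f ^^ n) u x \<longleftrightarrow> (\<exists>z. (f ^^ n) z = x \<and> \<alpha> \<le> u z)"
proof -
  have "(zadeh f ^^ n) u \<in> fuzzy_space \<and>
    (0 < \<alpha> \<longrightarrow> (\<forall>x. \<alpha> \<le> (zadeh f ^^ n) u x \<longleftrightarrow> (\<exists>z. (f ^^ n) z = x \<and> \<alpha> \<le> u z)))"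
  proof (induction n)
    case 0
    show ?case using u by simp
  next
    case (Suc n)
    then show ?case using zadeh_fuzzy_space[OF T2 cont] zadeh_ge_iff[OF T2 cont] by auto
  qed
  then show "(zadeh f ^^ n) u \<in> fuzzy_space"
    and "0 < \<alpha> \<Longrightarrow> \<alpha> \<le> (zadeh f ^^ n) u x \<longleftrightarrow> (\<exists>z. (f ^^ n) z = x \<and> \<alpha> \<le> u z)" by auto
qed

text \<open>The join of finitely many weighted points. A relation is used since chosen points may
  coincide with different weights; the inserted 0 is the value at points without a weight.\<close>

definition finite_fuzzy :: "('a \<times> real) set \<Rightarrow> 'a \<Rightarrow> real" where
  "finite_fuzzy S x = Max (insert 0 {a. (x, a) \<in> S})"

lemma finite_fuzzy_ge_iff:
  assumes "finite S" "0 < \<alpha>"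
  shows "\<alpha> \<le> finite_fuzzy S x \<longleftrightarrow> (\<exists>a\<ge>\<alpha>. (x, a) \<in> S)"
proof -
  have "{a. (x, a) \<in> S} \<subseteq> snd ` S" by force
  then have "finite {a. (x, a) \<in> S}" using assms(1) finite_subset by blast
  then show ?thesis using assms(2) by (auto simp: finite_fuzzy_def Max_ge_iff)
qed

lemma finite_fuzzy_fuzzy_space:
  fixes S :: "('a::topological_space \<times> real) set"
  assumes T2: "Hausdorff_space (euclidean :: 'a topology)" and S: "finite S"
    and le1: "\<And>x a. (x, a) \<in> S \<Longrightarrow> a \<le> 1" and top: "(z, 1) \<in> S"
  shows "finite_fuzzy S \<in> fuzzy_space"
proof -
  note ge = finite_fuzzy_ge_iff[OF S]
  have fin: "finite {a. (x, a) \<in> S}" for x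
    by (rule finite_subset[OF _ finite_imageI[OF S, of snd]]) force
  have nonneg: "0 \<le> finite_fuzzy S x" for x
    using fin[of x] by (simp add: finite_fuzzy_def)
  moreover have le: "finite_fuzzy S x \<le> 1" for x
    using fin[of x] le1 by (simp add: finite_fuzzy_def)
  moreover have "finite_fuzzy S z = 1" using ge[of 1 z] top le[of z] by (auto intro!: antisym)
  moreover have clo: "closed A" if "A \<subseteq> fst ` S" for A
    by (rule Hausdorff_compact_closed[OF T2 finite_imp_compact])
      (rule finite_subset[OF that finite_imageI[OF S]])
  have fst: "x \<in> fst ` S" if "0 < finite_fuzzy S x" for x
    using ge[OF that, of x] by force
  have "upper_semicont (finite_fuzzy S)"
    unfolding upper_semicont_def
  proof
    fix c
    show "open {x. finite_fuzzy S x < c}"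
    proof (cases "0 < c")
      case False
      then have "\<not> finite_fuzzy S x < c" for x using nonneg[of x] by simp
      then show ?thesis by simp
    next
      case True
      have "closed {x. c \<le> finite_fuzzy S x}"
        by (rule clo) (use fst True in auto)
      then have "open (- {x. c \<le> finite_fuzzy S x})" by (rule open_Compl)
      also have "- {x. c \<le> finite_fuzzy S x} = {x. finite_fuzzy S x < c}" by auto
      finally show ?thesis .
    qed
  qed
  moreover have "fuzzy_supp (finite_fuzzy S) \<subseteq> fst ` S"
    unfolding fuzzy_supp_def by (rule closure_minimal) (use fst clo in auto)
  then have "compact (fuzzy_supp (finite_fuzzy S))"
    by (intro finite_imp_compact) (rule finite_subset[OF _ finite_imageI[OF S]])
  ultimately show ?thesis unfolding fuzzy_space_def by auto
qed

section \<open>Continuous maps between the hyperspaces\<close>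

text \<open>This allows Skorokhod closeness to be read at level 0, where it compares the
  supports.\<close>

lemma time_change_0:
  assumes "t \<in> time_changes"
  shows "t 0 = 0"
proof -
  obtain s where "homeomorphism {0..1} {0..1} t s" and mono: "strict_mono_on {0..1} t"
    using assms by (auto simp: time_changes_def)
  then have im: "t ` {0..1} = {0..1}" by (simp add: homeomorphism_def)
  then obtain r where r: "r \<in> {0..1}" "t r = 0" by (metis atLeastAtMost_iff imageE order_refl zero_le_one)
  have "t 0 \<le> t r" using strict_mono_on_leD[OF mono] r(1) by simp
  moreover have "t 0 \<in> {0..1}" using im by (metis atLeastAtMost_iff image_eqI order_refl zero_le_one)
  ultimately show ?thesis using r(2) by simp
qed

lemma compact_sendograph:
  assumes "u \<in> fuzzy_space"
  shows "compact (sendograph u)"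
proof -
  have "closed {(x, \<alpha>). \<alpha> \<le> u x}"
  proof -
    have "open {(x, \<alpha>). u x < \<alpha>}"
    proof -
      \<comment> \<open>A number strictly between \<open>u x\<close> and \<alpha> gives an open box
        around the point, so the region above the graph is open.\<close>
      have "{(x, \<alpha>). u x < \<alpha>} = (\<Union>c. {x. u x < c} \<times> {c<..})"
        by (auto dest: dense)
      moreover have "open (\<Union>c. {x. u x < c} \<times> {c<..})"
        using fuzzy_spaceD(4)[OF assms] by (intro open_UN ballI open_Times) (auto simp: upper_semicont_def)
      ultimately show ?thesis by simp
    qed
    moreover have "- {(x, \<alpha>). \<alpha> \<le> u x} = {(x, \<alpha>). u x < \<alpha>}" by auto
    ultimately show ?thesis by (simp add: closed_def)
  qed
  moreover have "sendograph u = (fuzzy_supp u \<times> {0..1}) \<inter> {(x, \<alpha>). \<alpha> \<le> u x}"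
    unfolding sendograph_def by auto
  ultimately show ?thesis
    using fuzzy_spaceD(5)[OF assms] by (simp add: compact_Times compact_Int_closed)
qed

lemma sendograph_hyperspace:
  assumes "u \<in> fuzzy_space"
  shows "sendograph u \<in> hyperspace (UNIV \<times> {0..1})"
proof -
  obtain x where "u x = 1" using fuzzy_spaceD(3)[OF assms] by blast
  then have "(x, 1) \<in> sendograph u" using pos_in_fuzzy_supp[of u x] by (simp add: sendograph_def)
  then have "sendograph u \<noteq> {}" by blast
  moreover have "sendograph u \<subseteq> UNIV \<times> {0..1}" by (auto simp: sendograph_def)
  ultimately show ?thesis using compact_sendograph[OF assms] by (simp add: hyperspace_def)
qed

text \<open>At height 0 this relies on the restriction to the support in \<open>sendograph\<close>;
  otherwise the bottom slice would be the whole space.\<close>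

lemma sendograph_cut: "\<alpha> \<in> {0..1} \<Longrightarrow> u \<in> fuzzy_space \<Longrightarrow> (x, \<alpha>) \<in> sendograph u \<longleftrightarrow> x \<in> cut u \<alpha>"
  using pos_in_fuzzy_supp[of u x] fuzzy_spaceD(1)[of u x] by (auto simp: sendograph_def cut_def)

section \<open>Comparison of the three uniformities on fuzzy sets\<close>

lemma level_ent_subset_skorokhod_ent:
  assumes "0 < \<epsilon>"
  shows "level_ent U \<subseteq> skorokhod_ent U \<epsilon>"
proof -
  have "id \<in> time_changes"
    unfolding time_changes_def
    by (auto simp: strict_mono_on_def homeomorphism_def intro!: exI[of _ id])
  moreover have "time_norm id < \<epsilon>" using assms by (simp add: time_norm_def)
  ultimately show ?thesis unfolding level_ent_def skorokhod_ent_def by force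
qed

text \<open>Each point of one sendograph is matched with a point of the other at the same height, so
  only the \<open>U\<close>-component has to be controlled.\<close>

lemma level_ent_subset_sendograph_ent:
  assumes "0 < \<epsilon>"
  shows "level_ent U \<subseteq> sendograph_ent U \<epsilon>"
proof -
  have sub: "sendograph u \<subseteq> prod_ent U (unit_ent \<epsilon>) `` sendograph v"
    if uv: "u \<in> fuzzy_space" "v \<in> fuzzy_space"
      and cuts: "\<And>\<alpha>. \<alpha> \<in> {0..1} \<Longrightarrow> cut u \<alpha> \<subseteq> U `` cut v \<alpha>" for u v
  proof
    fix p assume p: "p \<in> sendograph u"
    obtain x \<alpha> where x: "p = (x, \<alpha>)" by fastforce
    have \<alpha>: "\<alpha> \<in> {0..1}" using p x by (auto simp: sendograph_def)
    then have "x \<in> cut u \<alpha>" using p x uv sendograph_cut by blast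
    then obtain y where "y \<in> cut v \<alpha>" "(y, x) \<in> U" using cuts[OF \<alpha>] by blast
    then have "(y, \<alpha>) \<in> sendograph v" "((y, \<alpha>), (x, \<alpha>)) \<in> prod_ent U (unit_ent \<epsilon>)"
      using sendograph_cut[OF \<alpha> uv(2)] \<alpha> assms by (auto simp: prod_ent_def unit_ent_def)
    then show "p \<in> prod_ent U (unit_ent \<epsilon>) `` sendograph v" using x by blast
  qed
  show ?thesis
  proof
    fix p assume "p \<in> level_ent U"
    then obtain u v where p: "p = (u, v)" "u \<in> fuzzy_space" "v \<in> fuzzy_space"
      "\<And>\<alpha>. \<alpha> \<in> {0..1} \<Longrightarrow> cut u \<alpha> \<subseteq> U `` cut v \<alpha> \<and> cut v \<alpha> \<subseteq> U `` cut u \<alpha>"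
      unfolding level_ent_def hyper_ent_def by auto
    then show "p \<in> sendograph_ent U \<epsilon>"
      using sub[of u v] sub[of v u] sendograph_hyperspace[of u] sendograph_hyperspace[of v]
      by (simp add: sendograph_ent_def hyper_ent_def)
  qed
qed

lemma continuous_map_level_skorokhod:
  "continuous_map (uniform_topology fuzzy_space level_uniformity)
     (uniform_topology fuzzy_space skorokhod_uniformity) (\<lambda>u. u)"
proof -
  have "openin (uniform_topology fuzzy_space level_uniformity) P"
    if P: "openin (uniform_topology fuzzy_space skorokhod_uniformity) P" for P :: "('a \<Rightarrow> real) set"
    unfolding openin_level
  proof (intro conjI ballI)
    show "P \<subseteq> fuzzy_space" using P unfolding openin_skorokhod by blast
    fix u assume "u \<in> P"
    then obtain U \<epsilon> where "U \<in> entourages" "\<epsilon> > 0" "skorokhod_ent U \<epsilon> `` {u} \<subseteq> P"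
      using P unfolding openin_skorokhod by blast
    then show "\<exists>U\<in>entourages. level_ent U `` {u} \<subseteq> P"
      using level_ent_subset_skorokhod_ent[of \<epsilon> U] by blast
  qed
  then show ?thesis
    unfolding continuous_map topspace_level topspace_skorokhod
    by (auto simp: Collect_conj_eq Int_absorb1 openin_skorokhod)
qed

lemma continuous_map_level_sendograph:
  "continuous_map (uniform_topology fuzzy_space level_uniformity)
     (uniform_topology fuzzy_space sendograph_uniformity) (\<lambda>u. u)"
proof -
  have "openin (uniform_topology fuzzy_space level_uniformity) P"
    if P: "openin (uniform_topology fuzzy_space sendograph_uniformity) P" for P :: "('a \<Rightarrow> real) set"
    unfolding openin_level
  proof (intro conjI ballI)
    show "P \<subseteq> fuzzy_space" using P unfolding openin_sendograph by blast
    fix u assume "u \<in> P"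
    then obtain U \<epsilon> where "U \<in> entourages" "\<epsilon> > 0" "sendograph_ent U \<epsilon> `` {u} \<subseteq> P"
      using P unfolding openin_sendograph by blast
    then show "\<exists>U\<in>entourages. level_ent U `` {u} \<subseteq> P"
      using level_ent_subset_sendograph_ent[of \<epsilon> U] by blast
  qed
  then show ?thesis
    unfolding continuous_map topspace_level topspace_sendograph
    by (auto simp: Collect_conj_eq Int_absorb1 openin_sendograph)
qed

section \<open>The support as a continuous map onto the hyperspace\<close>

lemma skorokhod_ent_supp:
  assumes "(u, v) \<in> skorokhod_ent U \<epsilon>"
  shows "(fuzzy_supp u, fuzzy_supp v) \<in> hyper_ent UNIV U"
proof -
  obtain t where t: "t \<in> time_changes" "\<forall>\<alpha>\<in>{0..1}. (cut u \<alpha>, cut v (t \<alpha>)) \<in> hyper_ent UNIV U"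
    using assms by (auto simp: skorokhod_ent_def)
  then have "(cut u 0, cut v 0) \<in> hyper_ent UNIV U" using time_change_0[OF t(1)] t(2)[rule_format, of 0] by simp
  then show ?thesis by (simp add: cut_def)
qed

text \<open>A support point, placed at height 0, is close to some point of the other sendograph, and
  the base point of the latter lies in the other support whatever its height.\<close>

lemma sendograph_ent_supp:
  fixes u v :: "'a::uniform_space \<Rightarrow> real"
  assumes "(u, v) \<in> sendograph_ent U \<epsilon>"
  shows "(fuzzy_supp u, fuzzy_supp v) \<in> hyper_ent UNIV U"
proof -
  have sub: "fuzzy_supp u \<subseteq> U `` fuzzy_supp v"
    if u: "u \<in> fuzzy_space" and sub: "sendograph u \<subseteq> prod_ent U (unit_ent \<epsilon>) `` sendograph v"
    for u v :: "'a \<Rightarrow> real"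
  proof
    fix x assume "x \<in> fuzzy_supp u"
    then have "(x, 0) \<in> sendograph u" using fuzzy_spaceD(1)[OF u] by (simp add: sendograph_def)
    then obtain y \<beta> where "(y, \<beta>) \<in> sendograph v" "((y, \<beta>), (x, 0)) \<in> prod_ent U (unit_ent \<epsilon>)"
      using sub by fastforce
    then show "x \<in> U `` fuzzy_supp v" by (auto simp: sendograph_def prod_ent_def)
  qed
  show ?thesis
    using assms sub[of u v] sub[of v u] fuzzy_supp_hyperspace
    by (auto simp: sendograph_ent_def hyper_ent_def)
qed

lemma continuous_map_skorokhod_hyper:
  "continuous_map (uniform_topology fuzzy_space skorokhod_uniformity)
     (uniform_topology (hyperspace UNIV) hyper_uniformity) fuzzy_supp"
  unfolding continuous_map topspace_hyper topspace_skorokhod openin_hyper openin_skorokhod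
proof (intro conjI allI impI ballI)
  show "fuzzy_supp ` fuzzy_space \<subseteq> hyperspace UNIV" using fuzzy_supp_hyperspace by blast
next
  fix P :: "'a set set" and u
  assume P: "P \<subseteq> hyperspace UNIV \<and> (\<forall>A\<in>P. \<exists>U\<in>entourages. hyper_ent UNIV U `` {A} \<subseteq> P)"
    and u: "u \<in> {x \<in> fuzzy_space. fuzzy_supp x \<in> P}"
  then obtain U where U: "U \<in> entourages" "hyper_ent UNIV U `` {fuzzy_supp u} \<subseteq> P" by blast
  \<comment> \<open>Any positive radius would do, since the comparison of supports does not depend
    on it.\<close>
  have "skorokhod_ent U 1 `` {u} \<subseteq> {x \<in> fuzzy_space. fuzzy_supp x \<in> P}"
    using skorokhod_ent_supp[of u _ U 1] U(2) by (auto simp: skorokhod_ent_def)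
  then show "\<exists>U\<in>entourages. \<exists>\<epsilon>>0. skorokhod_ent U \<epsilon> `` {u} \<subseteq> {x \<in> fuzzy_space. fuzzy_supp x \<in> P}"
    using U(1) zero_less_one by blast
qed auto

lemma continuous_map_sendograph_hyper:
  "continuous_map (uniform_topology fuzzy_space sendograph_uniformity)
     (uniform_topology (hyperspace UNIV) hyper_uniformity) fuzzy_supp"
  unfolding continuous_map topspace_hyper topspace_sendograph openin_hyper openin_sendograph
proof (intro conjI allI impI ballI)
  show "fuzzy_supp ` fuzzy_space \<subseteq> hyperspace UNIV" using fuzzy_supp_hyperspace by blast
next
  fix P :: "'a set set" and u
  assume P: "P \<subseteq> hyperspace UNIV \<and> (\<forall>A\<in>P. \<exists>U\<in>entourages. hyper_ent UNIV U `` {A} \<subseteq> P)"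
    and u: "u \<in> {x \<in> fuzzy_space. fuzzy_supp x \<in> P}"
  then obtain U where U: "U \<in> entourages" "hyper_ent UNIV U `` {fuzzy_supp u} \<subseteq> P" by blast
  have "sendograph_ent U 1 `` {u} \<subseteq> {x \<in> fuzzy_space. fuzzy_supp x \<in> P}"
    using sendograph_ent_supp[of u _ U 1] U(2) by (auto simp: sendograph_ent_def)
  then show "\<exists>U\<in>entourages. \<exists>\<epsilon>>0. sendograph_ent U \<epsilon> `` {u} \<subseteq> {x \<in> fuzzy_space. fuzzy_supp x \<in> P}"
    using U(1) zero_less_one by blast
qed auto

text \<open>The indicator of a compact set is a preimage; closedness of the set makes it upper
  semicontinuous with the right support.\<close>

lemma hyperspace_subset_fuzzy_supp:
  assumes T2: "Hausdorff_space (euclidean :: 'a::topological_space topology)"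
  shows "hyperspace (UNIV :: 'a set) \<subseteq> fuzzy_supp ` fuzzy_space"
proof
  fix K :: "'a set" assume "K \<in> hyperspace UNIV"
  then have K: "K \<noteq> {}" "compact K" by (auto simp: hyperspace_def)
  then have cl: "closed K" using Hausdorff_compact_closed[OF T2] by blast
  let ?u = "indicator K :: 'a \<Rightarrow> real"
  have "{x. 0 < ?u x} = K" by (auto simp: indicator_def)
  then have supp: "fuzzy_supp ?u = K" using cl by (simp add: fuzzy_supp_def)
  have "{x. ?u x < c} = (if c \<le> 0 then {} else if c \<le> 1 then - K else UNIV)" for c
    by (auto simp: indicator_def)
  then have "upper_semicont ?u" using cl by (simp add: upper_semicont_def open_Compl)
  moreover have "\<exists>x. ?u x = 1" using K(1) by (auto simp: indicator_def)
  ultimately have "?u \<in> fuzzy_space" using supp K(2) by (auto simp: fuzzy_space_def)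
  then show "K \<in> fuzzy_supp ` fuzzy_space" using supp by blast
qed

section \<open>From the hyperspace to weak mixing\<close>

lemma hyper_transitive_imp_weakly_mixing:
  fixes f :: "'a::uniform_space \<Rightarrow> 'a"
  assumes cont: "continuous_on UNIV f"
    and trans: "transitive_map (uniform_topology (hyperspace UNIV) hyper_uniformity) (image f)"
  shows "weakly_mixing_map euclidean f"
proof (rule weakly_mixingI[OF cont])
  fix A B C :: "'a set"
  assume ABC: "open A" "A \<noteq> {}" "open B" "B \<noteq> {}" "open C" "C \<noteq> {}"
  let ?P = "{K \<in> hyperspace UNIV. K \<subseteq> A}" and ?M = "\<lambda>B. {K \<in> hyperspace UNIV. K \<inter> B \<noteq> {}}"
  let ?T = "uniform_topology (hyperspace UNIV) hyper_uniformity"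
  have P: "openin ?T ?P"
    unfolding openin_hyper
  proof (intro conjI ballI)
    fix K assume K: "K \<in> ?P"
    then obtain U where U: "U \<in> entourages" "U `` K \<subseteq> A"
      using compact_subset_open_entourage[of K A] ABC(1) by (auto simp: hyperspace_def)
    then have "hyper_ent UNIV U `` {K} \<subseteq> ?P" by (auto simp: hyper_ent_def)
    then show "\<exists>U\<in>entourages. hyper_ent UNIV U `` {K} \<subseteq> ?P" using U(1) by blast
  qed auto
  have M: "openin ?T (?M B)" if B: "open B" for B
    unfolding openin_hyper
  proof (intro conjI ballI)
    fix K assume K: "K \<in> ?M B"
    then obtain x where x: "x \<in> K" "x \<in> B" by blast
    then obtain U where U: "U \<in> entourages" "U `` {x} \<subseteq> B"
      using B unfolding open_iff_entourages by blast
    \<comment> \<open>The converse fixes the orientation: the point of \<open>L\<close> near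
      \<open>x\<close> must be reached from \<open>x\<close> by \<open>U\<close>.\<close>
    have "hyper_ent UNIV (U\<inverse>) `` {K} \<subseteq> ?M B"
    proof
      fix L assume "L \<in> hyper_ent UNIV (U\<inverse>) `` {K}"
      then have L: "L \<in> hyperspace UNIV" "K \<subseteq> U\<inverse> `` L" by (auto simp: hyper_ent_def)
      then obtain y where "y \<in> L" "(x, y) \<in> U" using x(1) by blast
      then show "L \<in> ?M B" using L(1) U(2) by blast
    qed
    then show "\<exists>U\<in>entourages. hyper_ent UNIV U `` {K} \<subseteq> ?M B"
      using entourage_converse[OF U(1)] by blast
  qed auto
  obtain a b c where abc: "a \<in> A" "b \<in> B" "c \<in> C" using ABC by blast
  have "{a} \<in> ?P" "{b, c} \<in> ?M B \<inter> ?M C"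
    using abc by (auto simp: hyperspace_def)
  moreover have "openin ?T (?M B \<inter> ?M C)" using M ABC by (intro openin_Int) auto
  ultimately obtain n where n: "n \<ge> 1" "(image f ^^ n) ` ?P \<inter> (?M B \<inter> ?M C) \<noteq> {}"
    using trans[unfolded transitive_map_def, rule_format, of ?P "?M B \<inter> ?M C"] P by auto
  then obtain K where "K \<subseteq> A" "(f ^^ n) ` K \<inter> B \<noteq> {}" "(f ^^ n) ` K \<inter> C \<noteq> {}"
    unfolding image_funpow by blast
  then show "\<exists>n\<ge>1. (f ^^ n) ` A \<inter> B \<noteq> {} \<and> (f ^^ n) ` A \<inter> C \<noteq> {}"
    using n(1) by blast
qed

section \<open>From weak mixing to level-wise transitivity\<close>

text \<open>Closeness of all cuts is reduced to dominating each positive value at a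
  \<open>V\<close>-near point. At level 0 a further \<open>V\<close>-step moves from the closure to
  a point of positive value, which is why the result is stated for \<open>W\<close>.\<close>

lemma level_entI:
  assumes uv: "u \<in> fuzzy_space" "v \<in> fuzzy_space" and V: "V \<in> entourages" "sym V" "V \<subseteq> W" "V O V \<subseteq> W"
    and 1: "\<And>y. 0 < u y \<Longrightarrow> \<exists>x. u y \<le> v x \<and> (x, y) \<in> V"
    and 2: "\<And>y. 0 < v y \<Longrightarrow> \<exists>x. v y \<le> u x \<and> (x, y) \<in> V"
  shows "(u, v) \<in> level_ent W"
proof -
  have sub: "cut u \<alpha> \<subseteq> W `` cut v \<alpha>"
    if le: "\<And>y. 0 < u y \<Longrightarrow> \<exists>x. u y \<le> v x \<and> (x, y) \<in> V" and \<alpha>: "\<alpha> \<in> {0..1}" for u v \<alpha>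
  proof
    fix y assume y: "y \<in> cut u \<alpha>"
    show "y \<in> W `` cut v \<alpha>"
    proof (cases "\<alpha> = 0")
      case True
      then have "y \<in> closure {x. 0 < u x}" using y by (simp add: cut_def fuzzy_supp_def)
      then obtain y' where y': "y' \<in> {x. 0 < u x}" "(y, y') \<in> V"
        using closure_entourage[OF V(1)] by blast
      then obtain x where x: "u y' \<le> v x" "(x, y') \<in> V" using le by blast
      have "(x, y) \<in> W" using x(2) y'(2) V(2,4) by (auto dest: symD)
      moreover have "x \<in> fuzzy_supp v" using x(1) y'(1) by (intro pos_in_fuzzy_supp) simp
      ultimately show ?thesis using True by (auto simp: cut_def)
    next
      case False
      then have "\<alpha> \<le> u y" "0 < \<alpha>" using y \<alpha> by (auto simp: cut_def)
      then obtain x where "\<alpha> \<le> v x" "(x, y) \<in> V" using le[of y] by force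
      then show ?thesis using False V(3) by (auto simp: cut_def)
    qed
  qed
  show ?thesis
    using uv cut_hyperspace[OF uv(1)] cut_hyperspace[OF uv(2)] sub[OF 1] sub[OF 2] by (simp add: level_ent_def hyper_ent_def)
qed

text \<open>The two properties are those that \<open>level_entI\<close> asks for, and they hold for
  all points of each \<open>C\<close>: choosing any point in every \<open>C\<close> and giving it
  height \<open>c\<close> approximates \<open>u\<close>.\<close>

lemma finite_approximation:
  assumes u: "u \<in> fuzzy_space" and W: "W \<in> entourages"
  obtains S where "finite S"
    "\<And>C c. (C, c) \<in> S \<Longrightarrow> open C \<and> C \<noteq> {} \<and> 0 < c \<and> c \<le> 1 \<and> (\<forall>x\<in>C. \<exists>y. c \<le> u y \<and> (y, x) \<in> W)"
    "\<And>y. 0 < u y \<Longrightarrow> \<exists>(C, c)\<in>S. u y \<le> c \<and> (\<forall>x\<in>C. (x, y) \<in> W)"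
proof -
  \<comment> \<open>Two halvings: \<open>V'\<close> makes any two points of one \<open>N y\<close>
    \<open>V\<close>-close, and \<open>V\<close> leaves room for one more step to a point of its
    closure.\<close>
  obtain V where V: "V \<in> entourages" "sym V" "V \<subseteq> W" "V O V \<subseteq> W"
    using W by (rule entourage_half_sym)
  obtain V' where V': "V' \<in> entourages" "sym V'" "V' \<subseteq> V" "V' O V' \<subseteq> V"
    using V(1) by (rule entourage_half_sym)
  have "\<exists>N. open N \<and> y \<in> N \<and> N \<subseteq> V' `` {y}" for y
    by (rule entourage_open_nhd[OF V'(1)]) (intro exI conjI)
  then obtain N where N: "\<And>y. open (N y)" "\<And>y. y \<in> N y" "\<And>y. N y \<subseteq> V' `` {y}"
    by metis
  have small: "(x, z) \<in> V" if "x \<in> N y" "z \<in> N y" for x y z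
  proof -
    have "(y, x) \<in> V'" "(y, z) \<in> V'" using that N(3)[of y] by auto
    then have "(x, z) \<in> V' O V'" using V'(2) by (meson relcompI symD)
    then show ?thesis using V'(4) by (rule subsetD[rotated])
  qed
  \<comment> \<open>\<open>u y\<close> itself may be 0 or smaller than values nearby. The maximum is
    taken over the closure to have compactness, so \<open>z\<close> may lie outside
    \<open>N y\<close>.\<close>
  have "\<exists>z. y \<in> fuzzy_supp u \<longrightarrow> z \<in> closure (N y) \<and> 0 < u z \<and> (\<forall>x\<in>N y. u x \<le> u z)" for y
  proof (cases "y \<in> fuzzy_supp u")
    case y: True
    have "N y \<inter> closure {x. 0 < u x} \<noteq> {}"
      using y N(2)[of y] unfolding fuzzy_supp_def by blast
    then have "N y \<inter> {x. 0 < u x} \<noteq> {}"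
      using open_Int_closure_eq_empty[OF N(1)] by simp
    then obtain p where p: "p \<in> N y" "0 < u p" by blast
    let ?K = "fuzzy_supp u \<inter> closure (N y)"
    have "compact ?K" using fuzzy_spaceD(5)[OF u] by (intro compact_Int_closed) auto
    moreover have K: "x \<in> ?K" if "x \<in> N y" "0 < u x" for x
      using pos_in_fuzzy_supp[of u x] closure_subset[of "N y"] that by auto
    then have "?K \<noteq> {}" using p by auto
    ultimately obtain z where z: "z \<in> ?K" "\<And>x. x \<in> ?K \<Longrightarrow> u x \<le> u z"
      using fuzzy_spaceD(4)[OF u] by (rule upper_semicont_attains_max) blast
    have pz: "0 < u z" using z(2)[OF K[OF p]] p(2) by simp
    moreover have "u x \<le> u z" if "x \<in> N y" for x
    proof (cases "0 < u x")
      case True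
      show ?thesis by (rule z(2)[OF K[OF that True]])
    qed (use pz in simp)
    ultimately show ?thesis using z(1) by blast
  qed simp
  then obtain z where "\<And>y. y \<in> fuzzy_supp u \<longrightarrow>
      z y \<in> closure (N y) \<and> 0 < u (z y) \<and> (\<forall>x\<in>N y. u x \<le> u (z y))"
    by metis
  then have z: "z y \<in> closure (N y)" "0 < u (z y)" "\<And>x. x \<in> N y \<Longrightarrow> u x \<le> u (z y)"
    if "y \<in> fuzzy_supp u" for y using that by blast+
  have zW: "(z y, x) \<in> W" if y: "y \<in> fuzzy_supp u" and x: "x \<in> N y" for x y
  proof -
    obtain p where "p \<in> N y" "(z y, p) \<in> V"
      by (rule closure_entourage[OF V(1) z(1)[OF y]])
    then have "(z y, x) \<in> V O V" using small[OF _ x] by blast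
    then show ?thesis using V(4) by (rule subsetD[rotated])
  qed
  obtain F where F: "F \<subseteq> fuzzy_supp u" "finite F" "fuzzy_supp u \<subseteq> (\<Union>y\<in>F. N y)"
    using fuzzy_spaceD(5)[OF u]
    by (rule compactE_image[of "fuzzy_supp u" "fuzzy_supp u" N]) (use N(1,2) in auto)
  let ?S = "(\<lambda>y. (N y, u (z y))) ` F"
  show thesis
  proof (rule that[of ?S])
    show "finite ?S" using F(2) by simp
  next
    fix C c assume "(C, c) \<in> ?S"
    then obtain y where y: "y \<in> fuzzy_supp u" "C = N y" "c = u (z y)" using F(1) by blast
    then show "open C \<and> C \<noteq> {} \<and> 0 < c \<and> c \<le> 1 \<and> (\<forall>x\<in>C. \<exists>y. c \<le> u y \<and> (y, x) \<in> W)"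
      using N(1,2)[of y] z(2)[OF y(1)] zW[OF y(1)] fuzzy_spaceD(2)[OF u, of "z y"] by blast
  next
    fix y assume "0 < u y"
    then obtain p where p: "p \<in> F" "y \<in> N p" using pos_in_fuzzy_supp[of u y] F(3) by blast
    then have "p \<in> fuzzy_supp u" using F(1) by blast
    then have "u y \<le> u (z p) \<and> (\<forall>x\<in>N p. (x, y) \<in> W)"
      using z(3)[OF _ p(2)] small[OF _ p(2)] V(3) by blast
    then show "\<exists>(C, c)\<in>?S. u y \<le> c \<and> (\<forall>x\<in>C. (x, y) \<in> W)" using p(1) by auto
  qed
qed

text \<open>Given finite approximations of \<open>u\<close> by open sets \<open>C\<close> with heights \<open>c\<close> and of \<open>v\<close> by \<open>D\<close>, \<open>d\<close>,
  weak mixing provides points in every \<open>C\<close> that are mapped into any prescribed \<open>D\<close> at a common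
  time; giving them the heights \<open>min c d\<close> makes them approximate \<open>u\<close> and their images
  approximate \<open>v\<close>, because both families contain a set of height 1.\<close>

lemma weakly_mixing_imp_level_transitive:
  fixes f :: "'a::uniform_space \<Rightarrow> 'a"
  assumes T2: "Hausdorff_space (euclidean :: 'a topology)" and cont: "continuous_on UNIV f"
    and wm: "weakly_mixing_map euclidean f"
  shows "transitive_map (uniform_topology fuzzy_space level_uniformity) (zadeh f)"
  unfolding transitive_map_def openin_level
proof (intro allI impI)
  fix P Q :: "('a \<Rightarrow> real) set"
  assume "(P \<subseteq> fuzzy_space \<and> (\<forall>u\<in>P. \<exists>U\<in>entourages. level_ent U `` {u} \<subseteq> P)) \<and> P \<noteq> {} \<and>
    (Q \<subseteq> fuzzy_space \<and> (\<forall>u\<in>Q. \<exists>U\<in>entourages. level_ent U `` {u} \<subseteq> Q)) \<and> Q \<noteq> {}"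
  then have P: "P \<subseteq> fuzzy_space" "\<forall>u\<in>P. \<exists>U\<in>entourages. level_ent U `` {u} \<subseteq> P" "P \<noteq> {}"
    and Q: "Q \<subseteq> fuzzy_space" "\<forall>v\<in>Q. \<exists>U\<in>entourages. level_ent U `` {v} \<subseteq> Q" "Q \<noteq> {}"
    by auto
  obtain u U\<^sub>1 where u: "u \<in> fuzzy_space" and U1: "U\<^sub>1 \<in> entourages" "level_ent U\<^sub>1 `` {u} \<subseteq> P"
    using P by blast
  obtain v U\<^sub>2 where v: "v \<in> fuzzy_space" and U2: "U\<^sub>2 \<in> entourages" "level_ent U\<^sub>2 `` {v} \<subseteq> Q"
    using Q by blast
  define W where "W = U\<^sub>1 \<inter> U\<^sub>2"
  have W: "W \<in> entourages" using U1 U2 by (simp add: W_def Int_entourages)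
  have PQ: "level_ent W `` {u} \<subseteq> P" "level_ent W `` {v} \<subseteq> Q"
    using U1(2) U2(2) level_ent_mono[of W U\<^sub>1] level_ent_mono[of W U\<^sub>2] unfolding W_def by blast+
  obtain V where V: "V \<in> entourages" "sym V" "V \<subseteq> W" "V O V \<subseteq> W"
    using W by (rule entourage_half_sym)
  obtain S where S: "finite S"
    "\<And>C c. (C, c) \<in> S \<Longrightarrow> open C \<and> C \<noteq> {} \<and> 0 < c \<and> c \<le> 1 \<and> (\<forall>x\<in>C. \<exists>y. c \<le> u y \<and> (y, x) \<in> V)"
    "\<And>y. 0 < u y \<Longrightarrow> \<exists>(C, c)\<in>S. u y \<le> c \<and> (\<forall>x\<in>C. (x, y) \<in> V)"
    using u V(1) by (rule finite_approximation) blast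
  obtain R where R: "finite R"
    "\<And>C c. (C, c) \<in> R \<Longrightarrow> open C \<and> C \<noteq> {} \<and> 0 < c \<and> c \<le> 1 \<and> (\<forall>x\<in>C. \<exists>y. c \<le> v y \<and> (y, x) \<in> V)"
    "\<And>y. 0 < v y \<Longrightarrow> \<exists>(C, c)\<in>R. v y \<le> c \<and> (\<forall>x\<in>C. (x, y) \<in> V)"
    using v V(1) by (rule finite_approximation) blast
  have "\<exists>C. (C, 1) \<in> S"
  proof -
    obtain y where "u y = 1" using fuzzy_spaceD(3)[OF u] by blast
    then obtain C c where "(C, c) \<in> S" "1 \<le> c" using S(3)[of y] by auto
    then show ?thesis using S(2)[of C c] by (auto dest: antisym)
  qed
  then obtain C\<^sub>1 where C1: "(C\<^sub>1, 1) \<in> S" ..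
  have "\<exists>D. (D, 1) \<in> R"
  proof -
    obtain y where "v y = 1" using fuzzy_spaceD(3)[OF v] by blast
    then obtain C c where "(C, c) \<in> R" "1 \<le> c" using R(3)[of y] by auto
    then show ?thesis using R(2)[of C c] by (auto dest: antisym)
  qed
  then obtain D\<^sub>1 where D1: "(D\<^sub>1, 1) \<in> R" ..
  \<comment> \<open>All pairs are hit at one time, so the chosen points can be indexed by pairs of
    sets and every \<open>C\<close> can be combined with every \<open>D\<close>.\<close>
  obtain n where n: "n \<ge> 1" "\<And>A B. (A, B) \<in> fst ` S \<times> fst ` R \<Longrightarrow> (f ^^ n) ` A \<inter> B \<noteq> {}"
    by (rule weakly_mixing_finite[OF cont wm, of "fst ` S \<times> fst ` R"])
      (use S(1,2) R(1,2) in auto)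
  have "\<exists>x. x \<in> C \<and> (f ^^ n) x \<in> D" if "(C, c) \<in> S" "(D, d) \<in> R" for C c D d
    using n(2)[of C D] that by force
  then obtain p where p: "\<And>C c D d. (C, c) \<in> S \<Longrightarrow> (D, d) \<in> R \<Longrightarrow> p C D \<in> C \<and> (f ^^ n) (p C D) \<in> D"
    by metis
  define Z where "Z = (\<lambda>((C, c), (D, d)). (p C D, min c d)) ` (S \<times> R)"
  define w where "w = finite_fuzzy Z"
  have ZI: "(p C D, min c d) \<in> Z" if "(C, c) \<in> S" "(D, d) \<in> R" for C c D d
    unfolding Z_def using that by (force intro: rev_image_eqI[of "((C, c), (D, d))"])
  have ZE: "\<exists>C c D d. (C, c) \<in> S \<and> (D, d) \<in> R \<and> x = p C D \<and> a = min c d" if "(x, a) \<in> Z" for x a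
    using that unfolding Z_def by auto
  have finZ: "finite Z" using S(1) R(1) by (simp add: Z_def)
  have ge: "\<alpha> \<le> w x \<longleftrightarrow> (\<exists>a\<ge>\<alpha>. (x, a) \<in> Z)" if "0 < \<alpha>" for \<alpha> x
    unfolding w_def by (rule finite_fuzzy_ge_iff[OF finZ that])
  have w: "w \<in> fuzzy_space"
    unfolding w_def
  proof (rule finite_fuzzy_fuzzy_space[OF T2 finZ])
    show "a \<le> 1" if "(x, a) \<in> Z" for x a
      using ZE[OF that] S(2) by (metis min.coboundedI1)
    show "(p C\<^sub>1 D\<^sub>1, 1) \<in> Z" using ZI[OF C1 D1] by simp
  qed
  have "(u, w) \<in> level_ent W"
  proof (rule level_entI[OF u w V])
    fix y assume y: "0 < u y"
    then obtain C c where C: "(C, c) \<in> S" "u y \<le> c" "\<forall>x\<in>C. (x, y) \<in> V" using S(3)[of y] by auto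
    \<comment> \<open>The partner of height 1 keeps the full height \<open>c\<close>; the set of
      height 1 in \<open>S\<close> does the same for \<open>d\<close> below.\<close>
    have "min c 1 = c" using S(2)[OF C(1)] by simp
    then have "u y \<le> w (p C D\<^sub>1)" using ge[OF y] ZI[OF C(1) D1] C(2) by auto
    then show "\<exists>x. u y \<le> w x \<and> (x, y) \<in> V" using C p[OF C(1) D1] by blast
  next
    fix x assume x: "0 < w x"
    then obtain a where "w x \<le> a" "(x, a) \<in> Z" using ge[OF x, of x] by auto
    then obtain C c D d where C: "(C, c) \<in> S" "(D, d) \<in> R" "x = p C D" "w x \<le> c"
      using ZE by fastforce
    then obtain y where "c \<le> u y" "(y, x) \<in> V" using S(2)[OF C(1)] p[OF C(1,2)] by blast
    then show "\<exists>y. w x \<le> u y \<and> (y, x) \<in> V" using C(4) by force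
  qed
  moreover have "(v, (zadeh f ^^ n) w) \<in> level_ent W"
  proof (rule level_entI[OF v zadeh_funpow(1)[OF T2 cont w] V])
    fix y assume y: "0 < v y"
    then obtain D d where D: "(D, d) \<in> R" "v y \<le> d" "\<forall>x\<in>D. (x, y) \<in> V" using R(3)[of y] by auto
    have "min 1 d = d" using R(2)[OF D(1)] by simp
    then have "v y \<le> w (p C\<^sub>1 D)" using ge[OF y] ZI[OF C1 D(1)] D(2) by auto
    then have "v y \<le> (zadeh f ^^ n) w ((f ^^ n) (p C\<^sub>1 D))"
      using zadeh_funpow(2)[OF T2 cont w y] by blast
    then show "\<exists>x. v y \<le> (zadeh f ^^ n) w x \<and> (x, y) \<in> V" using D p[OF C1 D(1)] by blast
  next
    fix x assume x: "0 < (zadeh f ^^ n) w x"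
    define \<alpha> where "\<alpha> = (zadeh f ^^ n) w x"
    have "0 < \<alpha>" using x by (simp add: \<alpha>_def)
    obtain z where z: "(f ^^ n) z = x" "\<alpha> \<le> w z"
      using zadeh_funpow(2)[OF T2 cont w \<open>0 < \<alpha>\<close>, of n x] by (auto simp: \<alpha>_def)
    then obtain a where "\<alpha> \<le> a" "(z, a) \<in> Z" using ge[OF \<open>0 < \<alpha>\<close>] by auto
    then obtain C c D d where C: "(C, c) \<in> S" "(D, d) \<in> R" "z = p C D" "\<alpha> \<le> d"
      using ZE by fastforce
    then obtain y where "d \<le> v y" "(y, x) \<in> V" using R(2)[OF C(2)] p[OF C(1,2)] z(1) by blast
    then show "\<exists>y. (zadeh f ^^ n) w x \<le> v y \<and> (y, x) \<in> V" using C(4) unfolding \<alpha>_def by force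
  qed
  ultimately have "w \<in> P" "(zadeh f ^^ n) w \<in> Q" using PQ by blast+
  then show "\<exists>n\<ge>1. (zadeh f ^^ n) ` P \<inter> Q \<noteq> {}" using n(1) by blast
qed

theorem theorem3p7:
  fixes f :: "'a::uniform_space \<Rightarrow> 'a"
  assumes "separated_uniformity TYPE('a)"
    and "continuous_on UNIV f"
  shows "(weakly_mixing_map euclidean f \<longleftrightarrow>
            transitive_map (uniform_topology (hyperspace UNIV) hyper_uniformity) (image f)) \<and>
         (weakly_mixing_map euclidean f \<longleftrightarrow>
            transitive_map (uniform_topology fuzzy_space level_uniformity) (zadeh f)) \<and>
         (weakly_mixing_map euclidean f \<longleftrightarrow>
            transitive_map (uniform_topology fuzzy_space skorokhod_uniformity) (zadeh f)) \<and>
         (weakly_mixing_map euclidean f \<longleftrightarrow>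
            transitive_map (uniform_topology fuzzy_space sendograph_uniformity) (zadeh f))"
    (is "(?wm \<longleftrightarrow> ?K) \<and> (?wm \<longleftrightarrow> ?level) \<and> (?wm \<longleftrightarrow> ?skor) \<and> (?wm \<longleftrightarrow> ?send)")
proof -
  have T2: "Hausdorff_space (euclidean :: 'a topology)"
    using assms(1) by (rule separated_Hausdorff)
  note zadeh = zadeh_fuzzy_space[OF T2 assms(2)] fuzzy_supp_zadeh[OF T2 assms(2)]
  note surj = hyperspace_subset_fuzzy_supp[OF T2]
  have "?wm \<Longrightarrow> ?level" by (rule weakly_mixing_imp_level_transitive[OF T2 assms(2)])
  moreover have "?level \<Longrightarrow> ?skor"
    by (erule transitive_map_factor[OF _ continuous_map_level_skorokhod])
      (auto simp: topspace_level topspace_skorokhod zadeh)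
  moreover have "?level \<Longrightarrow> ?send"
    by (erule transitive_map_factor[OF _ continuous_map_level_sendograph])
      (auto simp: topspace_level topspace_sendograph zadeh)
  moreover have "?skor \<Longrightarrow> ?K"
    by (erule transitive_map_factor[OF _ continuous_map_skorokhod_hyper])
      (use surj in \<open>auto simp: topspace_hyper topspace_skorokhod zadeh\<close>)
  moreover have "?send \<Longrightarrow> ?K"
    by (erule transitive_map_factor[OF _ continuous_map_sendograph_hyper])
      (use surj in \<open>auto simp: topspace_hyper topspace_sendograph zadeh\<close>)
  moreover have "?K \<Longrightarrow> ?wm" by (rule hyper_transitive_imp_weakly_mixing[OF assms(2)])
  \<comment> \<open>The implications form two cycles through \<open>?wm\<close>,
    \<open>?level\<close> and \<open>?K\<close>, one over \<open>?skor\<close> and one over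
    \<open>?send\<close>.\<close>
  ultimately show ?thesis by blast
qed

end
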